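(* Let $\overline{M}$ be a normal indefinite complex contact manifold. Then $\overline{M}$ admits no null hypersurface $(M,g)$, tangent to the characteristic subbundle $\mathcal{V}$, that is totally umbilic; none that is screen totally umbilic; and none that is screen conformal.
   Context: Ambient manifold. $\overline{M}$ is a complex manifold of real dimension $4n+2$ with complex structure $J$ and a Hermitian semi-Riemannian metric $\overline{g}$ of index $4q$, $0<q<n$, with Levi-Civita connection $\overline{\nabla}$. It is an indefinite complex contact (metric) manifold: it has an open cover by coordinate neighbourhoods $\mathcal{O}$, carrying holomorphic 1-forms $\theta$ with $\theta\wedge(d\theta)^n\neq 0$ (related on overlaps by non-vanishing holomorphic factors), and on each $\mathcal{O}$ there are 1-forms $u$, $v=u\circ J$ (with $\theta$ equal to $u-iv$ up to a non-vanishing complex function), orthogonal dual vector fields $U$, $V=-JU$, and $(1,1)$-tensor fields $G$, $H=GJ$ with $G^2=H^2=-I+u\otimes U+v\otimes V$, $\overline{g}(GX,Y)=-\overline{g}(X,GY)$, $\overline{g}(U,X)=u(X)$, $GJ=-JG$, $GU=0$, $u(U)=1$; on overlaps $u'=au-bv$, $v'=bu+av$, $G'=aG-bH$, $H'=bG+aH$ with $a^2+b^2=1$; and $du(X,Y)=\overline{g}(X,GY)+(\sigma\wedge v)(X,Y)$, $dv(X,Y)=\overline{g}(X,HY)-(\sigma\wedge u)(X,Y)$, where $\sigma(X)=\overline{g}(\overline{\nabla}_XU,V)$ (convention: $d\omega(X,Y)=\frac12(X\omega(Y)-Y\omega(X)-\omega([X,Y]))$, $(\alpha\wedge\beta)(X,Y)=\frac12(\alpha(X)\beta(Y)-\alpha(Y)\beta(X))$).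 $\mathcal{V}=\mathrm{Span}\{U,V\}$ is the vertical (characteristic) subbundle, $\mathcal{H}$ its orthogonal complement, $p:T\overline{M}\to\mathcal{H}$ the projection. Put $h_U=\frac12\mathrm{sym}(\pounds_UG)\circ p$, $h_V=\frac12\mathrm{sym}(\pounds_VH)\circ p$ ($\mathrm{sym}$ = symmetric part). Then $\overline{\nabla}_XU=-GX-Gh_UX+\sigma(X)V$, $\overline{\nabla}_XV=-HX-Hh_VX-\sigma(X)U$. Normality. With $[G,G]$, $[H,H]$ the Nijenhuis tensors, let $S(X,Y)=[G,G](X,Y)+2\overline{g}(X,GY)U-2\overline{g}(X,HY)V+2\{v(Y)HX-v(X)HY\}+\sigma(GY)HX-\sigma(GX)HY+\sigma(X)GHY-\sigma(Y)GHX$, $T(X,Y)=[H,H](X,Y)-2\overline{g}(X,GY)U+2\overline{g}(X,HY)V+2\{u(Y)GX-u(X)GY\}+\sigma(HX)GY-\sigma(HY)GX+\sigma(X)GHY-\sigma(Y)GHX$. The structure is normal if $S(X,Y)=T(X,Y)=0$ for all $X,Y\in\Gamma(\mathcal{H})$ and $S(U,X)=T(V,X)=0$ for all $X$. A known consequence of normality is $h_U=h_V=0$. Null hypersurface. $(M,g)$ is a hypersurface of $\overline{M}$ whose induced tensor $g$ has constant corank 1; $TM^\perp\subset TM$ is its rank-1 normal bundle, $S(TM)$ a screen distribution, $TM=S(TM)\perp TM^\perp$, and $P:TM\to S(TM)$ the projection. For a local section $\xi\neq0$ of $TM^\perp$, $N$ is the unique section of the null transversal bundle $\mathrm{tr}(TM)$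 with $\overline{g}(\xi,N)=1$, $\overline{g}(N,N)=\overline{g}(N,Z)=0$ for $Z\in\Gamma(S(TM))$. The Gauss–Weingarten formulas are $\overline{\nabla}_XY=\nabla_XY+B(X,Y)N$, $\overline{\nabla}_XN=-A_NX+\tau(X)N$, $\nabla_XPY=\nabla^*_XPY+C(X,PY)\xi$, $\nabla_X\xi=-A^*_\xi X-\tau(X)\xi$ for $X,Y\in\Gamma(TM)$. Tangent to $\mathcal{V}$ means $\mathcal{V}\subset TM$ along $M$. Standing choice: $S(TM)$ is chosen so that it contains $\mathcal{V}$ and $J(TM^\perp),G(TM^\perp),H(TM^\perp)$, $J\,\mathrm{tr}(TM),G\,\mathrm{tr}(TM),H\,\mathrm{tr}(TM)$. Definitions. $M$ is totally umbilic if on each coordinate neighbourhood there is a smooth function $\rho$ with $B(X,PY)=\rho g(X,Y)$; screen totally umbilic if on each coordinate neighbourhood there is a smooth function $\varrho$ with $C(X,PY)=\varrho g(X,Y)$; screen (locally) conformal if on each coordinate neighbourhood there is a non-vanishing smooth function $\psi$ with $C(X,PY)=\psi B(X,Y)$; in each case for all $X,Y\in\Gamma(TM)$. *)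

theory Defs
  imports "HOL-Analysis.Analysis" "HOL-Combinatorics.Permutations"
begin

section \<open>Smooth and holomorphic functions on open subsets of a Euclidean space\<close>

primrec Ck_on :: "nat \<Rightarrow> ('x::euclidean_space \<Rightarrow> 'y::real_normed_vector) \<Rightarrow> 'x set \<Rightarrow> bool" where
  "Ck_on 0 f S \<longleftrightarrow> continuous_on S f"
| "Ck_on (Suc k) f S \<longleftrightarrow> (\<forall>x\<in>S. f differentiable (at x)) \<and>
     (\<forall>v. Ck_on k (\<lambda>x. frechet_derivative f (at x) v) S)"

text \<open>Only used for open \<open>S\<close>.\<close>

definition smooth_on :: "('x::euclidean_space \<Rightarrow> 'y::real_normed_vector) \<Rightarrow> 'x set \<Rightarrow> bool" where
  "smooth_on f S \<longleftrightarrow> (\<forall>k. Ck_on k f S)"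

text \<open>Multiplication by \<open>\<i>\<close> on the model space \<open>\<complex>\<^sup>k\<close>.\<close>

definition J :: "complex ^ 'k \<Rightarrow> complex ^ 'k" where
  "J v = \<i> *s v"

definition holo_map_on :: "(complex ^ 'k \<Rightarrow> complex ^ 'k) \<Rightarrow> (complex ^ 'k) set \<Rightarrow> bool" where
  "holo_map_on f S \<longleftrightarrow>
     (\<forall>x\<in>S. \<exists>D. (f has_derivative D) (at x) \<and> (\<forall>v. D (J v) = J (D v)))"

definition holo_scalar_on :: "(complex ^ 'k \<Rightarrow> complex) \<Rightarrow> (complex ^ 'k) set \<Rightarrow> bool" where
  "holo_scalar_on f S \<longleftrightarrow>
     (\<forall>x\<in>S. \<exists>D. (f has_derivative D) (at x) \<and> (\<forall>v. D (J v) = \<i> * D v))"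


section \<open>Manifolds\<close>

text \<open>
  The underlying set of a manifold is a type \<open>'a\<close>. A chart is a pair of a domain and a coordinate map
  into the model space \<open>'e\<close> (the map is irrelevant outside of the domain).
\<close>

type_synonym ('a, 'e) chart = "'a set \<times> ('a \<Rightarrow> 'e)"

definition param :: "('a, 'e) chart \<Rightarrow> 'e \<Rightarrow> 'a" where
  "param c = inv_into (fst c) (snd c)"

definition smooth_atlas :: "('a::topological_space, 'e::euclidean_space) chart set \<Rightarrow> bool" where
  "smooth_atlas A \<longleftrightarrow>
     (\<Union>c\<in>A. fst c) = UNIV \<and>
     (\<forall>c\<in>A. open (fst c) \<and> open (snd c ` fst c) \<and>
        homeomorphism (fst c) (snd c ` fst c) (snd c) (param c)) \<and>
     (\<forall>c\<in>A. \<forall>d\<in>A. smooth_on (snd d \<circ> param c) (snd c ` (fst c \<inter> fst d)))"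

definition holomorphic_atlas :: "('a::topological_space, complex ^ 'k) chart set \<Rightarrow> bool" where
  "holomorphic_atlas A \<longleftrightarrow> smooth_atlas A \<and>
     (\<forall>c\<in>A. \<forall>d\<in>A. holo_map_on (snd d \<circ> param c) (snd c ` (fst c \<inter> fst d)))"

text \<open>Coordinate neighbourhoods are the domains of all charts compatible with the given atlas.\<close>

definition coord_nbhd :: "('a::topological_space, 'e::euclidean_space) chart set \<Rightarrow> 'a set \<Rightarrow> bool" where
  "coord_nbhd A W \<longleftrightarrow> (\<exists>\<phi>. smooth_atlas (insert (W, \<phi>) A))"

definition holo_coord_nbhd :: "('a::topological_space, complex ^ 'k) chart set \<Rightarrow> 'a set \<Rightarrow> bool" where
  "holo_coord_nbhd A W \<longleftrightarrow> (\<exists>\<phi>. holomorphic_atlas (insert (W, \<phi>) A))"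

text \<open>
  A tangent vector at \<open>p\<close> is represented by its components with respect to one fixed chart
  \<open>chart_at A p\<close> around \<open>p\<close>. So every tangent space has the carrier \<open>'e\<close>, a vector field is a function
  \<open>'a \<Rightarrow> 'e\<close>, and all chart dependence is in the following conversions. On a complex manifold the
  coordinate changes have complex linear derivatives, so the complex structure is \<open>J\<close> at each point.
\<close>

definition chart_at :: "('a, 'e) chart set \<Rightarrow> 'a \<Rightarrow> ('a, 'e) chart" where
  "chart_at A p = (SOME c. c \<in> A \<and> p \<in> fst c)"

definition tchange :: "('a, 'e::euclidean_space) chart \<Rightarrow> ('a, 'e) chart \<Rightarrow> 'a \<Rightarrow> 'e \<Rightarrow> 'e" where
  "tchange c d p v = frechet_derivative (snd d \<circ> param c) (at (snd c p)) v"

text \<open>\<open>tcomp A c p v\<close>: the components of the tangent vector \<open>v\<close> at \<open>p\<close> in the chart \<open>c\<close>.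
  \<open>cfield A c w\<close>: the vector field on the domain of \<open>c\<close> with constant components \<open>w\<close> in \<open>c\<close>.\<close>

definition tcomp :: "('a, 'e::euclidean_space) chart set \<Rightarrow> ('a, 'e) chart \<Rightarrow> 'a \<Rightarrow> 'e \<Rightarrow> 'e" where
  "tcomp A c p v = tchange (chart_at A p) c p v"

definition cfield :: "('a, 'e::euclidean_space) chart set \<Rightarrow> ('a, 'e) chart \<Rightarrow> 'e \<Rightarrow> 'a \<Rightarrow> 'e" where
  "cfield A c w p = tchange c (chart_at A p) p w"

definition smooth_fun :: "('a, 'e::euclidean_space) chart set \<Rightarrow> 'a set \<Rightarrow>
    ('a \<Rightarrow> 'c::real_normed_vector) \<Rightarrow> bool" where
  "smooth_fun A W h \<longleftrightarrow> (\<forall>c\<in>A. smooth_on (h \<circ> param c) (snd c ` (fst c \<inter> W)))"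

definition smooth_vf :: "('a, 'e::euclidean_space) chart set \<Rightarrow> 'a set \<Rightarrow> ('a \<Rightarrow> 'e) \<Rightarrow> bool" where
  "smooth_vf A W X \<longleftrightarrow> (\<forall>c\<in>A. smooth_on (\<lambda>x. tcomp A c (param c x) (X (param c x)))
                             (snd c ` (fst c \<inter> W)))"

definition smooth_form :: "('a::topological_space, 'e::euclidean_space) chart set \<Rightarrow> 'a set \<Rightarrow>
    ('a \<Rightarrow> 'e \<Rightarrow> 'c::real_normed_vector) \<Rightarrow> bool" where
  "smooth_form A W \<omega> \<longleftrightarrow> (\<forall>p\<in>W. linear (\<omega> p)) \<and>
     (\<forall>W' X. open W' \<and> W' \<subseteq> W \<and> smooth_vf A W' X \<longrightarrow> smooth_fun A W' (\<lambda>p. \<omega> p (X p)))"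

definition smooth_endo :: "('a::topological_space, 'e::euclidean_space) chart set \<Rightarrow> 'a set \<Rightarrow>
    ('a \<Rightarrow> 'e \<Rightarrow> 'e) \<Rightarrow> bool" where
  "smooth_endo A W F \<longleftrightarrow> (\<forall>p\<in>W. linear (F p)) \<and>
     (\<forall>W' X. open W' \<and> W' \<subseteq> W \<and> smooth_vf A W' X \<longrightarrow> smooth_vf A W' (\<lambda>p. F p (X p)))"

text \<open>\<open>dfun A h p v\<close> is the derivative of \<open>h\<close> along the tangent vector \<open>v\<close> at \<open>p\<close>.\<close>

definition dfun :: "('a, 'e::euclidean_space) chart set \<Rightarrow> ('a \<Rightarrow> 'c::real_normed_vector) \<Rightarrow>
    'a \<Rightarrow> 'e \<Rightarrow> 'c" where
  "dfun A h p v = frechet_derivative (h \<circ> param (chart_at A p)) (at (snd (chart_at A p) p)) v"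

definition lie_bracket :: "('a, 'e::euclidean_space) chart set \<Rightarrow> ('a \<Rightarrow> 'e) \<Rightarrow> ('a \<Rightarrow> 'e) \<Rightarrow> 'a \<Rightarrow> 'e" where
  "lie_bracket A X Y p =
     (let c = chart_at A p;
          loc = (\<lambda>Z x. tcomp A c (param c x) (Z (param c x)))
      in frechet_derivative (loc Y) (at (snd c p)) (X p)
         - frechet_derivative (loc X) (at (snd c p)) (Y p))"

text \<open>Exterior derivative and wedge product of 1-forms, with the factor \<open>1/2\<close>.\<close>

definition ext_d :: "('a, 'e::euclidean_space) chart set \<Rightarrow> ('a \<Rightarrow> 'e \<Rightarrow> 'c::real_normed_vector) \<Rightarrow>
    ('a \<Rightarrow> 'e) \<Rightarrow> ('a \<Rightarrow> 'e) \<Rightarrow> 'a \<Rightarrow> 'c" where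
  "ext_d A \<omega> X Y p = (1/2) *\<^sub>R (dfun A (\<lambda>q. \<omega> q (Y q)) p (X p) - dfun A (\<lambda>q. \<omega> q (X q)) p (Y p)
                              - \<omega> p (lie_bracket A X Y p))"

definition wedge1 :: "('e \<Rightarrow> real) \<Rightarrow> ('e \<Rightarrow> real) \<Rightarrow> 'e \<Rightarrow> 'e \<Rightarrow> real" where
  "wedge1 \<alpha> \<beta> v w = (1/2) * (\<alpha> v * \<beta> w - \<alpha> w * \<beta> v)"

text \<open>The 2-form \<open>d\<omega>\<close> on two tangent vectors at \<open>p\<close>, extended by coordinate fields.\<close>

definition ext_d_at :: "('a, 'e::euclidean_space) chart set \<Rightarrow> ('a \<Rightarrow> 'e \<Rightarrow> 'c::real_normed_vector) \<Rightarrow>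
    'a \<Rightarrow> 'e \<Rightarrow> 'e \<Rightarrow> 'c" where
  "ext_d_at A \<omega> p v w = ext_d A \<omega> (cfield A (chart_at A p) v) (cfield A (chart_at A p) w) p"

text \<open>The value of the \<open>(2n+1)\<close>-form \<open>\<theta> \<and> (d\<theta>)\<^sup>n\<close> at \<open>p\<close> on the vectors \<open>w 0, \<dots>, w (2n)\<close>: the
  alternation of \<open>\<theta> \<otimes> d\<theta> \<otimes> \<dots> \<otimes> d\<theta>\<close>.\<close>

definition contact_top_form :: "nat \<Rightarrow> ('a, complex ^ 'k) chart set \<Rightarrow>
    ('a \<Rightarrow> complex ^ 'k \<Rightarrow> complex) \<Rightarrow> 'a \<Rightarrow> (nat \<Rightarrow> complex ^ 'k) \<Rightarrow> complex" where
  "contact_top_form n A \<theta> p w =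
     (\<Sum>\<pi> | \<pi> permutes {..2*n}. of_int (sign \<pi>) * \<theta> p (w (\<pi> 0)) *
        (\<Prod>j<n. ext_d_at A \<theta> p (w (\<pi> (2*j+1))) (w (\<pi> (2*j+2))))) / fact (2*n+1)"

definition holo_fun :: "('a, complex ^ 'k) chart set \<Rightarrow> 'a set \<Rightarrow> ('a \<Rightarrow> complex) \<Rightarrow> bool" where
  "holo_fun A W h \<longleftrightarrow> (\<forall>c\<in>A. holo_scalar_on (h \<circ> param c) (snd c ` (fst c \<inter> W)))"

text \<open>A holomorphic 1-form has type \<open>(1,0)\<close> and holomorphic components in all charts.\<close>

definition holo_form :: "('a::topological_space, complex ^ 'k) chart set \<Rightarrow> 'a set \<Rightarrow>
    ('a \<Rightarrow> complex ^ 'k \<Rightarrow> complex) \<Rightarrow> bool" where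
  "holo_form A W \<theta> \<longleftrightarrow>
     smooth_form A W \<theta> \<and> (\<forall>p\<in>W. \<forall>v. \<theta> p (J v) = \<i> * \<theta> p v) \<and>
     (\<forall>c\<in>A. \<forall>w. holo_scalar_on (\<lambda>x. \<theta> (param c x) (cfield A c w (param c x)))
                   (snd c ` (fst c \<inter> W)))"


section \<open>Semi-Riemannian metrics and the Levi-Civita connection\<close>

text \<open>The value \<open>conn p v Y\<close> of a connection is the covariant derivative at \<open>p\<close> of the vector field \<open>Y\<close>
  (smooth near \<open>p\<close>) along the tangent vector \<open>v\<close> at \<open>p\<close>.\<close>

record ('a, 'e) ambient =
  atlas :: "('a, 'e) chart set"
  metric :: "'a \<Rightarrow> 'e \<Rightarrow> 'e \<Rightarrow> real"
  conn :: "'a \<Rightarrow> 'e \<Rightarrow> ('a \<Rightarrow> 'e) \<Rightarrow> 'e"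

definition form_index :: "('e::euclidean_space \<Rightarrow> 'e \<Rightarrow> real) \<Rightarrow> nat" where
  "form_index b = Max {dim S | S. subspace S \<and> (\<forall>v\<in>S. v \<noteq> 0 \<longrightarrow> b v v < 0)}"

definition semi_riemannian :: "nat \<Rightarrow> ('a::topological_space, 'e::euclidean_space) ambient \<Rightarrow> bool" where
  "semi_riemannian r M \<longleftrightarrow>
     (\<forall>p. bilinear (metric M p) \<and> (\<forall>v w. metric M p v w = metric M p w v) \<and>
          (\<forall>v. (\<forall>w. metric M p v w = 0) \<longrightarrow> v = 0) \<and> form_index (metric M p) = r) \<and>
     (\<forall>W X Y. open W \<and> smooth_vf (atlas M) W X \<and> smooth_vf (atlas M) W Y \<longrightarrow>
          smooth_fun (atlas M) W (\<lambda>p. metric M p (X p) (Y p)))"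

definition affine_connection :: "('a::topological_space, 'e::euclidean_space) ambient \<Rightarrow> bool" where
  "affine_connection M \<longleftrightarrow>
     (\<forall>W X Y Z h. open W \<and> smooth_vf (atlas M) W X \<and> smooth_vf (atlas M) W Y \<and>
          smooth_vf (atlas M) W Z \<and> smooth_fun (atlas M) W (h :: 'a \<Rightarrow> real) \<longrightarrow>
        smooth_vf (atlas M) W (\<lambda>p. conn M p (X p) Y) \<and>
        (\<forall>p\<in>W. linear (\<lambda>v. conn M p v Y) \<and>
          (\<forall>v. conn M p v (\<lambda>q. Y q + Z q) = conn M p v Y + conn M p v Z \<and>
               conn M p v (\<lambda>q. h q *\<^sub>R Y q) = dfun (atlas M) h p v *\<^sub>R Y p + h p *\<^sub>R conn M p v Y)))"

definition levi_civita :: "('a::topological_space, 'e::euclidean_space) ambient \<Rightarrow> bool" where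
  "levi_civita M \<longleftrightarrow> affine_connection M \<and>
     (\<forall>W X Y Z. open W \<and> smooth_vf (atlas M) W X \<and> smooth_vf (atlas M) W Y \<and> smooth_vf (atlas M) W Z \<longrightarrow>
        (\<forall>p\<in>W. conn M p (X p) Y - conn M p (Y p) X = lie_bracket (atlas M) X Y p \<and>
               dfun (atlas M) (\<lambda>q. metric M q (Y q) (Z q)) p (X p)
                 = metric M p (conn M p (X p) Y) (Z p) + metric M p (Y p) (conn M p (X p) Z)))"


section \<open>Indefinite complex contact manifolds\<close>

text \<open>The local data on a coordinate neighbourhood; \<open>v\<close>, \<open>V\<close>, \<open>H\<close> and \<open>\<sigma>\<close> are determined by them.\<close>

record ('a, 'e) patch =
  pdom :: "'a set"
  ctheta :: "'a \<Rightarrow> 'e \<Rightarrow> complex"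
  formu :: "'a \<Rightarrow> 'e \<Rightarrow> real"
  vecU :: "'a \<Rightarrow> 'e"
  tenG :: "'a \<Rightarrow> 'e \<Rightarrow> 'e"

definition formv :: "('a, complex ^ 'k) patch \<Rightarrow> 'a \<Rightarrow> complex ^ 'k \<Rightarrow> real" where
  "formv c p x = formu c p (J x)"

definition vecV :: "('a, complex ^ 'k) patch \<Rightarrow> 'a \<Rightarrow> complex ^ 'k" where
  "vecV c p = - J (vecU c p)"

definition tenH :: "('a, complex ^ 'k) patch \<Rightarrow> 'a \<Rightarrow> complex ^ 'k \<Rightarrow> complex ^ 'k" where
  "tenH c p x = tenG c p (J x)"

definition sigma :: "('a, complex ^ 'k) ambient \<Rightarrow> ('a, complex ^ 'k) patch \<Rightarrow>
    'a \<Rightarrow> complex ^ 'k \<Rightarrow> real" where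
  "sigma M c p x = metric M p (conn M p x (vecU c)) (vecV c p)"

definition contact_patch :: "nat \<Rightarrow> ('a::topological_space, complex ^ 'k) ambient \<Rightarrow>
    ('a, complex ^ 'k) patch \<Rightarrow> bool" where
  "contact_patch n M c \<longleftrightarrow>
     holo_coord_nbhd (atlas M) (pdom c) \<and>
     holo_form (atlas M) (pdom c) (ctheta c) \<and>
     (\<forall>p\<in>pdom c. \<exists>w. contact_top_form n (atlas M) (ctheta c) p w \<noteq> 0) \<and>
     smooth_form (atlas M) (pdom c) (formu c) \<and>
     smooth_vf (atlas M) (pdom c) (vecU c) \<and>
     smooth_endo (atlas M) (pdom c) (tenG c) \<and>
     (\<exists>h. \<forall>p\<in>pdom c. h p \<noteq> 0 \<and>
        (\<forall>x. ctheta c p x = h p * (of_real (formu c p x) - \<i> * of_real (formv c p x)))) \<and>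
     (\<forall>p\<in>pdom c.
        formu c p (vecU c p) = 1 \<and>
        metric M p (vecU c p) (vecV c p) = 0 \<and>
        tenG c p (vecU c p) = 0 \<and>
        (\<forall>x. metric M p (vecU c p) x = formu c p x \<and>
             tenG c p (tenG c p x) = - x + formu c p x *\<^sub>R vecU c p + formv c p x *\<^sub>R vecV c p \<and>
             tenH c p (tenH c p x) = - x + formu c p x *\<^sub>R vecU c p + formv c p x *\<^sub>R vecV c p \<and>
             tenG c p (J x) = - J (tenG c p x)) \<and>
        (\<forall>x y. metric M p (tenG c p x) y = - metric M p x (tenG c p y))) \<and>
     (\<forall>W X Y. open W \<and> W \<subseteq> pdom c \<and> smooth_vf (atlas M) W X \<and> smooth_vf (atlas M) W Y \<longrightarrow>
        (\<forall>p\<in>W.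
           ext_d (atlas M) (formu c) X Y p
             = metric M p (X p) (tenG c p (Y p)) + wedge1 (sigma M c p) (formv c p) (X p) (Y p) \<and>
           ext_d (atlas M) (formv c) X Y p
             = metric M p (X p) (tenH c p (Y p)) - wedge1 (sigma M c p) (formu c p) (X p) (Y p)))"

definition patches_agree :: "('a::topological_space, complex ^ 'k) ambient \<Rightarrow>
    ('a, complex ^ 'k) patch \<Rightarrow> ('a, complex ^ 'k) patch \<Rightarrow> bool" where
  "patches_agree M c d \<longleftrightarrow>
     (\<exists>h. holo_fun (atlas M) (pdom c \<inter> pdom d) h \<and>
        (\<forall>p\<in>pdom c \<inter> pdom d. h p \<noteq> 0 \<and> (\<forall>x. ctheta d p x = h p * ctheta c p x))) \<and>
     (\<exists>a b :: 'a \<Rightarrow> real.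
        smooth_fun (atlas M) (pdom c \<inter> pdom d) a \<and> smooth_fun (atlas M) (pdom c \<inter> pdom d) b \<and>
        (\<forall>p\<in>pdom c \<inter> pdom d. (a p)\<^sup>2 + (b p)\<^sup>2 = 1 \<and>
          (\<forall>x. formu d p x = a p * formu c p x - b p * formv c p x \<and>
               formv d p x = b p * formu c p x + a p * formv c p x \<and>
               tenG d p x = a p *\<^sub>R tenG c p x - b p *\<^sub>R tenH c p x \<and>
               tenH d p x = b p *\<^sub>R tenG c p x + a p *\<^sub>R tenH c p x)))"

definition indefinite_complex_contact :: "nat \<Rightarrow> nat \<Rightarrow>
    ('a::topological_space, complex ^ 'k) ambient \<Rightarrow> ('a, complex ^ 'k) patch set \<Rightarrow> bool" where
  "indefinite_complex_contact n q M \<C> \<longleftrightarrow>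
     CARD('k) = 2 * n + 1 \<and> 0 < q \<and> q < n \<and>
     holomorphic_atlas (atlas M) \<and>
     semi_riemannian (4 * q) M \<and>
     (\<forall>p x y. metric M p (J x) (J y) = metric M p x y) \<and>
     levi_civita M \<and>
     (\<Union>c\<in>\<C>. pdom c) = UNIV \<and>
     (\<forall>c\<in>\<C>. contact_patch n M c) \<and>
     (\<forall>c\<in>\<C>. \<forall>d\<in>\<C>. patches_agree M c d)"

definition nijenhuis :: "('a, 'e::euclidean_space) chart set \<Rightarrow> ('a \<Rightarrow> 'e \<Rightarrow> 'e) \<Rightarrow>
    ('a \<Rightarrow> 'e) \<Rightarrow> ('a \<Rightarrow> 'e) \<Rightarrow> 'a \<Rightarrow> 'e" where
  "nijenhuis A F X Y p =
     F p (F p (lie_bracket A X Y p)) + lie_bracket A (\<lambda>q. F q (X q)) (\<lambda>q. F q (Y q)) p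
     - F p (lie_bracket A (\<lambda>q. F q (X q)) Y p) - F p (lie_bracket A X (\<lambda>q. F q (Y q)) p)"

definition tensor_S :: "('a, complex ^ 'k) ambient \<Rightarrow> ('a, complex ^ 'k) patch \<Rightarrow>
    ('a \<Rightarrow> complex ^ 'k) \<Rightarrow> ('a \<Rightarrow> complex ^ 'k) \<Rightarrow> 'a \<Rightarrow> complex ^ 'k" where
  "tensor_S M c X Y p =
     (let g = metric M p; G = tenG c p; H = tenH c p; s = sigma M c p; v = formv c p;
          x = X p; y = Y p
      in nijenhuis (atlas M) (tenG c) X Y p
         + (2 * g x (G y)) *\<^sub>R vecU c p - (2 * g x (H y)) *\<^sub>R vecV c p
         + 2 *\<^sub>R (v y *\<^sub>R H x - v x *\<^sub>R H y)
         + s (G y) *\<^sub>R H x - s (G x) *\<^sub>R H y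
         + s x *\<^sub>R G (H y) - s y *\<^sub>R G (H x))"

definition tensor_T :: "('a, complex ^ 'k) ambient \<Rightarrow> ('a, complex ^ 'k) patch \<Rightarrow>
    ('a \<Rightarrow> complex ^ 'k) \<Rightarrow> ('a \<Rightarrow> complex ^ 'k) \<Rightarrow> 'a \<Rightarrow> complex ^ 'k" where
  "tensor_T M c X Y p =
     (let g = metric M p; G = tenG c p; H = tenH c p; s = sigma M c p; u = formu c p;
          x = X p; y = Y p
      in nijenhuis (atlas M) (tenH c) X Y p
         - (2 * g x (G y)) *\<^sub>R vecU c p + (2 * g x (H y)) *\<^sub>R vecV c p
         + 2 *\<^sub>R (u y *\<^sub>R G x - u x *\<^sub>R G y)
         + s (H x) *\<^sub>R G y - s (H y) *\<^sub>R G x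
         + s x *\<^sub>R G (H y) - s y *\<^sub>R G (H x))"

definition vertical :: "('a, complex ^ 'k) patch \<Rightarrow> 'a \<Rightarrow> (complex ^ 'k) set" where
  "vertical c p = span {vecU c p, vecV c p}"

definition horizontal :: "('a, complex ^ 'k) ambient \<Rightarrow> ('a, complex ^ 'k) patch \<Rightarrow>
    'a \<Rightarrow> (complex ^ 'k) set" where
  "horizontal M c p = {x. \<forall>z\<in>vertical c p. metric M p x z = 0}"

definition normal_contact :: "('a::topological_space, complex ^ 'k) ambient \<Rightarrow>
    ('a, complex ^ 'k) patch set \<Rightarrow> bool" where
  "normal_contact M \<C> \<longleftrightarrow>
     (\<forall>c\<in>\<C>. \<forall>W X Y. open W \<and> W \<subseteq> pdom c \<and> smooth_vf (atlas M) W X \<and> smooth_vf (atlas M) W Y \<longrightarrow>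
        ((\<forall>p\<in>W. X p \<in> horizontal M c p \<and> Y p \<in> horizontal M c p) \<longrightarrow>
           (\<forall>p\<in>W. tensor_S M c X Y p = 0 \<and> tensor_T M c X Y p = 0)) \<and>
        (\<forall>p\<in>W. tensor_S M c (vecU c) X p = 0 \<and> tensor_T M c (vecV c) X p = 0))"


section \<open>Null hypersurfaces\<close>

text \<open>An immersed hypersurface (a map \<open>emb\<close> into the ambient manifold) together with a distribution along it. Tangent spaces
  of the hypersurface are identified with their images under the differential of \<open>emb\<close>; so vector fields
  on it are vector fields along \<open>emb\<close> with values in \<open>tangent\<close>.\<close>

record ('b, 'f, 'a, 'e) hypersurface =
  hatlas :: "('b, 'f) chart set"
  emb :: "'b \<Rightarrow> 'a"
  screen :: "'b \<Rightarrow> 'e set"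

definition tmap :: "('a, 'e::euclidean_space) ambient \<Rightarrow> ('b, 'f::euclidean_space, 'a, 'e) hypersurface \<Rightarrow>
    'b \<Rightarrow> 'f \<Rightarrow> 'e" where
  "tmap M N p v =
     frechet_derivative (snd (chart_at (atlas M) (emb N p)) \<circ> emb N \<circ> param (chart_at (hatlas N) p))
       (at (snd (chart_at (hatlas N) p) p)) v"

definition tangent :: "('a, 'e::euclidean_space) ambient \<Rightarrow> ('b, 'f::euclidean_space, 'a, 'e) hypersurface \<Rightarrow>
    'b \<Rightarrow> 'e set" where
  "tangent M N p = range (tmap M N p)"

definition induced_metric :: "('a, 'e::euclidean_space) ambient \<Rightarrow>
    ('b, 'f::euclidean_space, 'a, 'e) hypersurface \<Rightarrow> 'b \<Rightarrow> 'f \<Rightarrow> 'f \<Rightarrow> real" where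
  "induced_metric M N p x y = metric M (emb N p) (tmap M N p x) (tmap M N p y)"

definition immersed_hypersurface :: "('a::topological_space, 'e::euclidean_space) ambient \<Rightarrow>
    ('b::topological_space, 'f::euclidean_space, 'a, 'e) hypersurface \<Rightarrow> bool" where
  "immersed_hypersurface M N \<longleftrightarrow>
     DIM('f) + 1 = DIM('e) \<and> smooth_atlas (hatlas N) \<and> continuous_on UNIV (emb N) \<and>
     (\<forall>c\<in>hatlas N. \<forall>d\<in>atlas M.
        smooth_on (snd d \<circ> emb N \<circ> param c) (snd c ` (fst c \<inter> emb N -` fst d))) \<and>
     (\<forall>p. inj (tmap M N p))"

definition smooth_along :: "('a, 'e::euclidean_space) ambient \<Rightarrow>
    ('b, 'f::euclidean_space, 'a, 'e) hypersurface \<Rightarrow> 'b set \<Rightarrow> ('b \<Rightarrow> 'e) \<Rightarrow> bool" where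
  "smooth_along M N W Y \<longleftrightarrow>
     (\<forall>c\<in>hatlas N. \<forall>d\<in>atlas M.
        smooth_on (\<lambda>x. tcomp (atlas M) d (emb N (param c x)) (Y (param c x)))
          (snd c ` (fst c \<inter> W \<inter> emb N -` fst d)))"

definition subbundle :: "('a, 'e::euclidean_space) ambient \<Rightarrow>
    ('b::topological_space, 'f::euclidean_space, 'a, 'e) hypersurface \<Rightarrow> nat \<Rightarrow> ('b \<Rightarrow> 'e set) \<Rightarrow> bool" where
  "subbundle M N r E \<longleftrightarrow>
     (\<forall>p. \<exists>W e. open W \<and> p \<in> W \<and> (\<forall>i<r. smooth_along M N W (e i)) \<and>
        (\<forall>q\<in>W. E q = span ((\<lambda>i. e i q) ` {..<r}) \<and> dim (E q) = r))"

definition normal_space :: "('a, 'e::euclidean_space) ambient \<Rightarrow>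
    ('b, 'f::euclidean_space, 'a, 'e) hypersurface \<Rightarrow> 'b \<Rightarrow> 'e set" where
  "normal_space M N p = {w. \<forall>z\<in>tangent M N p. metric M (emb N p) w z = 0}"

definition null_hypersurface :: "('a::topological_space, 'e::euclidean_space) ambient \<Rightarrow>
    ('b::topological_space, 'f::euclidean_space, 'a, 'e) hypersurface \<Rightarrow> bool" where
  "null_hypersurface M N \<longleftrightarrow> immersed_hypersurface M N \<and>
     (\<forall>p. dim {x. \<forall>y. induced_metric M N p x y = 0} = 1) \<and>
     (\<forall>p. normal_space M N p \<subseteq> tangent M N p) \<and> subbundle M N 1 (normal_space M N)"

definition screen_distribution :: "('a::topological_space, 'e::euclidean_space) ambient \<Rightarrow>
    ('b::topological_space, 'f::euclidean_space, 'a, 'e) hypersurface \<Rightarrow> bool" where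
  "screen_distribution M N \<longleftrightarrow>
     subbundle M N (DIM('f) - 1) (screen N) \<and>
     (\<forall>p. screen N p \<inter> normal_space M N p = {0} \<and>
          {s + w | s w. s \<in> screen N p \<and> w \<in> normal_space M N p} = tangent M N p \<and>
          (\<forall>s\<in>screen N p. \<forall>w\<in>normal_space M N p. metric M (emb N p) s w = 0))"

text \<open>The value at \<open>p\<close> of the null transversal section that belongs to \<open>\<xi>\<close>, as a function of the value of \<open>\<xi>\<close>
  at \<open>p\<close>; and the null transversal bundle, which these values span.\<close>

definition null_transversal :: "('a, 'e::euclidean_space) ambient \<Rightarrow>
    ('b, 'f::euclidean_space, 'a, 'e) hypersurface \<Rightarrow> 'b \<Rightarrow> 'e \<Rightarrow> 'e" where
  "null_transversal M N p x =
     (THE n. metric M (emb N p) x n = 1 \<and> metric M (emb N p) n n = 0 \<and>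
             (\<forall>z\<in>screen N p. metric M (emb N p) n z = 0))"

definition transversal_space :: "('a, 'e::euclidean_space) ambient \<Rightarrow>
    ('b, 'f::euclidean_space, 'a, 'e) hypersurface \<Rightarrow> 'b \<Rightarrow> 'e set" where
  "transversal_space M N p = (\<Union>x\<in>normal_space M N p - {0}. span {null_transversal M N p x})"

definition tangent_to_vertical :: "('a, complex ^ 'k) ambient \<Rightarrow> ('a, complex ^ 'k) patch set \<Rightarrow>
    ('b, 'f::euclidean_space, 'a, complex ^ 'k) hypersurface \<Rightarrow> bool" where
  "tangent_to_vertical M \<C> N \<longleftrightarrow>
     (\<forall>c\<in>\<C>. \<forall>p. emb N p \<in> pdom c \<longrightarrow> vertical c (emb N p) \<subseteq> tangent M N p)"

definition adapted_screen :: "('a, complex ^ 'k) ambient \<Rightarrow> ('a, complex ^ 'k) patch set \<Rightarrow>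
    ('b, 'f::euclidean_space, 'a, complex ^ 'k) hypersurface \<Rightarrow> bool" where
  "adapted_screen M \<C> N \<longleftrightarrow>
     (\<forall>c\<in>\<C>. \<forall>p. emb N p \<in> pdom c \<longrightarrow>
        vertical c (emb N p) \<subseteq> screen N p \<and>
        (\<forall>F\<in>{J, tenG c (emb N p), tenH c (emb N p)}.
           F ` normal_space M N p \<subseteq> screen N p \<and> F ` transversal_space M N p \<subseteq> screen N p))"

definition tangent_field :: "('a, 'e::euclidean_space) ambient \<Rightarrow>
    ('b, 'f::euclidean_space, 'a, 'e) hypersurface \<Rightarrow> 'b set \<Rightarrow> ('b \<Rightarrow> 'e) \<Rightarrow> bool" where
  "tangent_field M N W X \<longleftrightarrow> smooth_along M N W X \<and> (\<forall>p\<in>W. X p \<in> tangent M N p)"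

definition null_section :: "('a, 'e::euclidean_space) ambient \<Rightarrow>
    ('b, 'f::euclidean_space, 'a, 'e) hypersurface \<Rightarrow> 'b set \<Rightarrow> ('b \<Rightarrow> 'e) \<Rightarrow> bool" where
  "null_section M N W \<xi> \<longleftrightarrow> smooth_along M N W \<xi> \<and> (\<forall>p\<in>W. \<xi> p \<in> normal_space M N p \<and> \<xi> p \<noteq> 0)"

definition screen_proj :: "('a, 'e::euclidean_space) ambient \<Rightarrow>
    ('b, 'f::euclidean_space, 'a, 'e) hypersurface \<Rightarrow> 'b \<Rightarrow> 'e \<Rightarrow> 'e" where
  "screen_proj M N p x = (THE s. s \<in> screen N p \<and> x - s \<in> normal_space M N p)"

text \<open>
  The covariant derivative in the ambient manifold of a field \<open>Y\<close> along \<open>emb\<close> (the pull-back connection):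
  if \<open>Y = y\<^sup>i \<partial>\<^sub>i\<close> in the ambient chart at \<open>emb p\<close>, it is \<open>v(y\<^sup>i) \<partial>\<^sub>i + y\<^sup>i \<nabla>\<^sub>v \<partial>\<^sub>i\<close>. It agrees with the
  derivative along \<open>v\<close> of any local extension of \<open>Y\<close> to the ambient manifold. Here \<open>v\<close> is in \<open>tangent\<close>.
\<close>

definition conn_along :: "('a, 'e::euclidean_space) ambient \<Rightarrow>
    ('b, 'f::euclidean_space, 'a, 'e) hypersurface \<Rightarrow> 'b \<Rightarrow> 'e \<Rightarrow> ('b \<Rightarrow> 'e) \<Rightarrow> 'e" where
  "conn_along M N p v Y =
     (let c = chart_at (hatlas N) p; d = chart_at (atlas M) (emb N p)
      in frechet_derivative (\<lambda>x. tcomp (atlas M) d (emb N (param c x)) (Y (param c x))) (at (snd c p))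
           (inv (tmap M N p) v)
         + conn M (emb N p) v (cfield (atlas M) d (Y p)))"

text \<open>The Gauss formulas, which decompose the tangent space of the ambient manifold along the hypersurface
  into \<open>tangent\<close> and the line of the null transversal section, and \<open>tangent\<close> into \<open>screen\<close> and the line
  of \<open>\<xi>\<close>: \<open>second_form\<close> is \<open>B\<close>, \<open>induced_conn\<close> is \<open>\<nabla>\<close>, and \<open>screen_form\<close> is \<open>C\<close> (to be used for sections
  \<open>Z\<close> of the screen distribution).\<close>

definition second_form :: "('a, 'e::euclidean_space) ambient \<Rightarrow>
    ('b, 'f::euclidean_space, 'a, 'e) hypersurface \<Rightarrow> ('b \<Rightarrow> 'e) \<Rightarrow> ('b \<Rightarrow> 'e) \<Rightarrow> ('b \<Rightarrow> 'e) \<Rightarrow> 'b \<Rightarrow> real" where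
  "second_form M N \<xi> X Y p =
     (THE b. \<exists>t\<in>tangent M N p. conn_along M N p (X p) Y = t + b *\<^sub>R null_transversal M N p (\<xi> p))"

definition induced_conn :: "('a, 'e::euclidean_space) ambient \<Rightarrow>
    ('b, 'f::euclidean_space, 'a, 'e) hypersurface \<Rightarrow> ('b \<Rightarrow> 'e) \<Rightarrow> ('b \<Rightarrow> 'e) \<Rightarrow> ('b \<Rightarrow> 'e) \<Rightarrow> 'b \<Rightarrow> 'e" where
  "induced_conn M N \<xi> X Y p =
     (THE t. t \<in> tangent M N p \<and>
        (\<exists>b. conn_along M N p (X p) Y = t + b *\<^sub>R null_transversal M N p (\<xi> p)))"

definition screen_form :: "('a, 'e::euclidean_space) ambient \<Rightarrow>
    ('b, 'f::euclidean_space, 'a, 'e) hypersurface \<Rightarrow> ('b \<Rightarrow> 'e) \<Rightarrow> ('b \<Rightarrow> 'e) \<Rightarrow> ('b \<Rightarrow> 'e) \<Rightarrow> 'b \<Rightarrow> real" where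
  "screen_form M N \<xi> X Z p =
     (THE b. \<exists>s\<in>screen N p. induced_conn M N \<xi> X Z p = s + b *\<^sub>R \<xi> p)"

definition totally_umbilic :: "('a, 'e::euclidean_space) ambient \<Rightarrow>
    ('b::topological_space, 'f::euclidean_space, 'a, 'e) hypersurface \<Rightarrow> bool" where
  "totally_umbilic M N \<longleftrightarrow>
     (\<forall>W \<xi>. coord_nbhd (hatlas N) W \<and> null_section M N W \<xi> \<longrightarrow>
        (\<exists>\<rho> :: 'b \<Rightarrow> real. smooth_fun (hatlas N) W \<rho> \<and>
          (\<forall>X Y. tangent_field M N W X \<and> tangent_field M N W Y \<longrightarrow>
             (\<forall>p\<in>W. second_form M N \<xi> X (\<lambda>q. screen_proj M N q (Y q)) p
                      = \<rho> p * metric M (emb N p) (X p) (Y p)))))"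

definition screen_totally_umbilic :: "('a, 'e::euclidean_space) ambient \<Rightarrow>
    ('b::topological_space, 'f::euclidean_space, 'a, 'e) hypersurface \<Rightarrow> bool" where
  "screen_totally_umbilic M N \<longleftrightarrow>
     (\<forall>W \<xi>. coord_nbhd (hatlas N) W \<and> null_section M N W \<xi> \<longrightarrow>
        (\<exists>\<rho> :: 'b \<Rightarrow> real. smooth_fun (hatlas N) W \<rho> \<and>
          (\<forall>X Y. tangent_field M N W X \<and> tangent_field M N W Y \<longrightarrow>
             (\<forall>p\<in>W. screen_form M N \<xi> X (\<lambda>q. screen_proj M N q (Y q)) p
                      = \<rho> p * metric M (emb N p) (X p) (Y p)))))"

definition screen_conformal :: "('a, 'e::euclidean_space) ambient \<Rightarrow>
    ('b::topological_space, 'f::euclidean_space, 'a, 'e) hypersurface \<Rightarrow> bool" where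
  "screen_conformal M N \<longleftrightarrow>
     (\<forall>W \<xi>. coord_nbhd (hatlas N) W \<and> null_section M N W \<xi> \<longrightarrow>
        (\<exists>\<psi> :: 'b \<Rightarrow> real. smooth_fun (hatlas N) W \<psi> \<and> (\<forall>p\<in>W. \<psi> p \<noteq> 0) \<and>
          (\<forall>X Y. tangent_field M N W X \<and> tangent_field M N W Y \<longrightarrow>
             (\<forall>p\<in>W. screen_form M N \<xi> X (\<lambda>q. screen_proj M N q (Y q)) p
                      = \<psi> p * second_form M N \<xi> X Y p))))"

end

theory Submission
  imports Defs
begin

text \<open>
  Write \<open>a(X, Y) = g(\<nabla>\<^sub>X U, Y)\<close>. The theorem comes down to one identity, \<open>a(GX, Y) = g(X, Y)\<close> for
  horizontal \<open>X\<close> and \<open>Y\<close> (lemma \<open>metric_conn_U\<close>). Along the hypersurface, \<open>\<xi>\<close> and \<open>N\<close> are horizontal, because the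
  screen contains \<open>U\<close> and \<open>V\<close>, and the Gauss formulas give \<open>B(X, U) = a(X, \<xi>)\<close> and \<open>C(X, U) = a(X, N)\<close>. So

    \<^item> \<open>B(GN, U) = g(N, \<xi>) = 1\<close>, whereas umbilicity makes it \<open>\<rho> g(GN, U) = 0\<close>;
    \<^item> \<open>C(G\<xi>, U) = g(\<xi>, N) = 1\<close>, whereas screen umbilicity makes it \<open>\<rho> g(G\<xi>, U) = 0\<close>;
    \<^item> \<open>C(G\<xi>, U) = 1\<close>, whereas screen conformality makes it \<open>\<psi> B(G\<xi>, U) = \<psi> g(\<xi>, \<xi>) = 0\<close>.

  The vectors \<open>GN\<close> and \<open>G\<xi>\<close> are tangent to the hypersurface, since they lie in the screen.

  The identity has a skew and a symmetric half. The skew part of \<open>a\<close> is \<open>du\<close>, which the contact structure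
  prescribes: \<open>a(X, Y) - a(Y, X) = 2 g(X, GY)\<close> on horizontal vectors. The symmetric part of \<open>a\<close> is the Lie derivative
  of the metric along \<open>U\<close>, and it vanishes on horizontal vectors (lemma \<open>Killing_at\<close>). This is the only place
  where normality enters. The equation \<open>S(U, X) = 0\<close> determines the horizontal part of the Lie derivative of \<open>G\<close> along \<open>U\<close>; the equation
  \<open>d(du) = 0\<close> on \<open>U, X, Y\<close> determines the Lie derivative of \<open>g(X, GY)\<close> along \<open>U\<close>, because the terms with \<open>d\<sigma>\<close>
  drop out on these arguments. In the difference of the two equations, the derivative of \<open>G\<close> and the terms
  with \<open>\<sigma>\<close> cancel, and only the Lie derivative of the metric remains.

  Both equations are written in the chart \<open>chart_at\<close> of the point in question, where tangent vectors are their own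
  components. The exterior derivative has to be known in a neighbourhood of the point, though, and for this the change of charts
  is needed: coordinate fields commute (lemma \<open>lie_bracket_cfield\<close>). This and \<open>d(du) = 0\<close> rest on the symmetry of
  second derivatives.
\<close>

section \<open>Smooth functions and the symmetry of second derivatives\<close>

lemma frechet_derivative_apply:
  "(f has_derivative f') (at x) \<Longrightarrow> frechet_derivative f (at x) v = f' v"
  using frechet_derivative_at by metis

lemma Ck_on_subset: "Ck_on k f S \<Longrightarrow> T \<subseteq> S \<Longrightarrow> Ck_on k f T"
  by (induction k arbitrary: f) (auto intro: continuous_on_subset)

lemma Ck_on_cong:
  assumes "open S" "\<And>x. x \<in> S \<Longrightarrow> f x = g x" "Ck_on k f S"
  shows "Ck_on k g S"
  using assms(2,3)
proof (induction k arbitrary: f g)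
  case 0
  then show ?case by (simp cong: continuous_on_cong)
next
  case (Suc k)
  have D: "(g has_derivative frechet_derivative f (at x)) (at x)" if "x \<in> S" for x
    using Suc.prems that assms(1)
    by (auto simp: frechet_derivative_works intro: has_derivative_transform_within_open[where f = f])
  then have eq: "frechet_derivative f (at x) = frechet_derivative g (at x)" if "x \<in> S" for x
    using that frechet_derivative_at by blast
  have "Ck_on k (\<lambda>x. frechet_derivative g (at x) v) S" for v
    by (rule Suc.IH[where f = "\<lambda>x. frechet_derivative f (at x) v"]) (use Suc.prems eq in auto)
  then show ?case using D by (auto simp: differentiable_def)
qed

lemma Ck_on_SucD: "Ck_on (Suc k) f S \<Longrightarrow> Ck_on k f S"
proof (induction k arbitrary: f)
  case 0
  then show ?case
    by (auto intro!: continuous_at_imp_continuous_on differentiable_imp_continuous_within)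
next
  case (Suc k)
  then show ?case by (metis Ck_on.simps(2))
qed

text \<open>Derivatives are unique, so any family of them may take the place of \<open>frechet_derivative\<close>.\<close>

lemma Ck_on_SucI:
  assumes "open S" "\<And>x. x \<in> S \<Longrightarrow> (f has_derivative D x) (at x)"
    and "\<And>v. Ck_on k (\<lambda>x. D x v) S"
  shows "Ck_on (Suc k) f S"
proof -
  have "Ck_on k (\<lambda>x. frechet_derivative f (at x) v) S" for v
    by (rule Ck_on_cong[OF assms(1) _ assms(3)[of v]]) (use assms(2) frechet_derivative_at in metis)
  then show ?thesis using assms(2) by (auto simp: differentiable_def)
qed

lemma Ck_on_SucE:
  assumes "Ck_on (Suc k) f S" "x \<in> S"
  shows "(f has_derivative frechet_derivative f (at x)) (at x)"
  using assms by (simp add: frechet_derivative_works)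

lemma Ck_on_const: "open S \<Longrightarrow> Ck_on k (\<lambda>x. c) S"
  by (induction k arbitrary: c) auto

lemma Ck_on_add:
  assumes "open S"
  shows "Ck_on k f S \<Longrightarrow> Ck_on k g S \<Longrightarrow> Ck_on k (\<lambda>x. f x + g x) S"
proof (induction k arbitrary: f g)
  case 0
  then show ?case by (auto intro: continuous_on_add)
next
  case (Suc k)
  show ?case
    by (rule Ck_on_SucI[OF assms has_derivative_add[OF Ck_on_SucE[OF Suc.prems(1)] Ck_on_SucE[OF Suc.prems(2)]]])
      (use Suc in auto)
qed

lemma Ck_on_sum:
  "open S \<Longrightarrow> (\<And>i. i \<in> I \<Longrightarrow> Ck_on k (f i) S) \<Longrightarrow> Ck_on k (\<lambda>x. \<Sum>i\<in>I. f i x) S"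
  by (induction I rule: infinite_finite_induct) (auto intro: Ck_on_add Ck_on_const)

lemma (in bounded_bilinear) Ck_on_prod:
  assumes "open S"
  shows "Ck_on k f S \<Longrightarrow> Ck_on k g S \<Longrightarrow> Ck_on k (\<lambda>x. prod (f x) (g x)) S"
proof (induction k arbitrary: f g)
  case 0
  then show ?case by (auto intro: continuous_on)
next
  case (Suc k)
  show ?case
  proof (rule Ck_on_SucI[OF assms])
    show "((\<lambda>x. prod (f x) (g x)) has_derivative
        (\<lambda>v. prod (f x) (frechet_derivative g (at x) v) + prod (frechet_derivative f (at x) v) (g x))) (at x)"
      if "x \<in> S" for x
      by (rule FDERIV[OF Ck_on_SucE[OF Suc.prems(1) that] Ck_on_SucE[OF Suc.prems(2) that]])
    show "Ck_on k (\<lambda>x. prod (f x) (frechet_derivative g (at x) v) + prod (frechet_derivative f (at x) v) (g x)) S" for v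
    proof (intro Ck_on_add assms Suc.IH)
      show "Ck_on k f S" "Ck_on k g S" using Suc.prems by (blast intro: Ck_on_SucD)+
      show "Ck_on k (\<lambda>x. frechet_derivative g (at x) v) S" "Ck_on k (\<lambda>x. frechet_derivative f (at x) v) S"
        using Suc.prems by simp_all
    qed
  qed
qed

lemma Ck_on_linear:
  assumes "open S" "bounded_linear L"
  shows "Ck_on k f S \<Longrightarrow> Ck_on k (\<lambda>x. L (f x)) S"
proof (induction k arbitrary: f)
  case 0
  then show ?case by (auto intro: bounded_linear.continuous_on[OF assms(2)])
next
  case (Suc k)
  show ?case
    by (rule Ck_on_SucI[OF assms(1) bounded_linear.has_derivative[OF assms(2) Ck_on_SucE[OF Suc.prems]]])
      (use Suc in auto)
qed

text \<open>Expanding the inner derivative in the standard basis writes the derivative of \<open>f \<circ> g\<close> as a sum of products of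
  \<open>C\<^sup>k\<close> functions, one factor being a partial derivative of \<open>f\<close> composed with \<open>g\<close>; so the induction goes through
  with \<open>f\<close> arbitrary.\<close>

lemma Ck_on_compose:
  fixes g :: "'x::euclidean_space \<Rightarrow> 'y::euclidean_space" and f :: "'y \<Rightarrow> 'z::real_normed_vector"
  assumes "open S" "open T" "g ` S \<subseteq> T"
  shows "Ck_on k f T \<Longrightarrow> Ck_on k g S \<Longrightarrow> Ck_on k (f \<circ> g) S"
proof (induction k arbitrary: f)
  case 0
  then show ?case using assms(3) unfolding Ck_on.simps by (blast intro: continuous_on_compose continuous_on_subset)
next
  case (Suc k)
  let ?D = "\<lambda>x v. \<Sum>b\<in>Basis. (frechet_derivative g (at x) v \<bullet> b) *\<^sub>R frechet_derivative f (at (g x)) b"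
  have D: "((f \<circ> g) has_derivative ?D x) (at x)" if x: "x \<in> S" for x
  proof -
    have df: "(f has_derivative frechet_derivative f (at (g x))) (at (g x))"
      using Ck_on_SucE[OF Suc.prems(1)] x assms(3) by auto
    interpret F: linear "frechet_derivative f (at (g x))"
      using df by (rule has_derivative_linear)
    have "((f \<circ> g) has_derivative frechet_derivative f (at (g x)) \<circ> frechet_derivative g (at x)) (at x)"
      by (rule diff_chain_at[OF Ck_on_SucE[OF Suc.prems(2) x] df])
    moreover have "frechet_derivative f (at (g x)) \<circ> frechet_derivative g (at x) = ?D x"
    proof
      fix v
      let ?w = "frechet_derivative g (at x) v"
      have "frechet_derivative f (at (g x)) ?w
          = frechet_derivative f (at (g x)) (\<Sum>b\<in>Basis. (?w \<bullet> b) *\<^sub>R b)"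
        by (simp add: euclidean_representation)
      then show "(frechet_derivative f (at (g x)) \<circ> frechet_derivative g (at x)) v = ?D x v"
        by (simp add: F.sum F.scale)
    qed
    ultimately show ?thesis by simp
  qed
  have "Ck_on k (\<lambda>x. ?D x v) S" for v
  proof (intro Ck_on_sum assms(1) bounded_bilinear.Ck_on_prod[OF bounded_bilinear_scaleR assms(1)])
    fix b :: 'y
    show "Ck_on k (\<lambda>x. frechet_derivative g (at x) v \<bullet> b) S"
      using Suc.prems(2) by (auto intro!: Ck_on_linear[OF assms(1) bounded_linear_inner_left])
    have "Ck_on k ((\<lambda>y. frechet_derivative f (at y) b) \<circ> g) S"
      by (rule Suc.IH) (use Suc.prems Ck_on_SucD in auto)
    then show "Ck_on k (\<lambda>x. frechet_derivative f (at (g x)) b) S" by (simp add: o_def)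
  qed
  then show ?case by (intro Ck_on_SucI[OF assms(1) D])
qed

lemma smooth_on_subset: "smooth_on f S \<Longrightarrow> T \<subseteq> S \<Longrightarrow> smooth_on f T"
  by (auto simp: smooth_on_def intro: Ck_on_subset)

lemma smooth_on_cong:
  "open S \<Longrightarrow> smooth_on f S \<Longrightarrow> (\<And>x. x \<in> S \<Longrightarrow> f x = g x) \<Longrightarrow> smooth_on g S"
  by (auto simp: smooth_on_def intro: Ck_on_cong[of S f g])

lemma smooth_on_const: "open S \<Longrightarrow> smooth_on (\<lambda>x. c) S"
  by (simp add: smooth_on_def Ck_on_const)

lemma smooth_on_linear: "open S \<Longrightarrow> bounded_linear L \<Longrightarrow> smooth_on f S \<Longrightarrow> smooth_on (\<lambda>x. L (f x)) S"
  by (simp add: smooth_on_def Ck_on_linear)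

lemma smooth_on_compose:
  fixes g :: "'x::euclidean_space \<Rightarrow> 'y::euclidean_space"
  shows "open S \<Longrightarrow> open T \<Longrightarrow> g ` S \<subseteq> T \<Longrightarrow> smooth_on f T \<Longrightarrow> smooth_on g S \<Longrightarrow> smooth_on (f \<circ> g) S"
  by (simp add: smooth_on_def Ck_on_compose)

lemma smooth_on_frechet: "smooth_on f S \<Longrightarrow> smooth_on (\<lambda>x. frechet_derivative f (at x) v) S"
  unfolding smooth_on_def by (metis Ck_on.simps(2))

lemma smooth_on_has_derivative:
  "smooth_on f S \<Longrightarrow> x \<in> S \<Longrightarrow> (f has_derivative frechet_derivative f (at x)) (at x)"
  unfolding smooth_on_def using Ck_on_SucE by blast

lemma smooth_on_continuous: "smooth_on f S \<Longrightarrow> continuous_on S f"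
  unfolding smooth_on_def by (metis Ck_on.simps(1))

lemma has_real_derivative_along_line:
  fixes f :: "'x::real_normed_vector \<Rightarrow> real"
  assumes "(f has_derivative f') (at (x + s *\<^sub>R v))"
  shows "((\<lambda>s. f (x + s *\<^sub>R v)) has_real_derivative f' v) (at s)"
proof -
  have "((\<lambda>s. x + s *\<^sub>R v) has_derivative (\<lambda>h. h *\<^sub>R v)) (at s)"
    by (auto intro!: derivative_eq_intros)
  from has_derivative_compose[OF this assms]
  have "((\<lambda>s. f (x + s *\<^sub>R v)) has_derivative (\<lambda>h. h * f' v)) (at s)"
    by (simp add: linear_cmul[OF has_derivative_linear[OF assms]])
  moreover have "(\<lambda>h. h * f' v) = (*) (f' v)" by (auto simp: mult.commute)
  ultimately show ?thesis by (simp add: has_field_derivative_def)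
qed

text \<open>The second difference is symmetric in \<open>v\<close> and \<open>w\<close>. Applying the mean value theorem first in the direction \<open>v\<close>, then in
  the direction \<open>w\<close> expresses it by a second derivative at a nearby point.\<close>

lemma second_difference_tendsto:
  fixes f :: "'x::euclidean_space \<Rightarrow> real"
  assumes S: "open S" "x \<in> S" and f: "smooth_on f S"
  shows "((\<lambda>t. (f (x + t *\<^sub>R v + t *\<^sub>R w) - f (x + t *\<^sub>R v) - f (x + t *\<^sub>R w) + f x) / t\<^sup>2)
           \<longlongrightarrow> frechet_derivative (\<lambda>y. frechet_derivative f (at y) v) (at x) w) (at_right 0)"
proof -
  let ?f1 = "\<lambda>y. frechet_derivative f (at y) v"
  let ?f2 = "\<lambda>y. frechet_derivative ?f1 (at y) w"
  have f1: "smooth_on ?f1 S" and f2: "smooth_on ?f2 S"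
    using f by (auto intro: smooth_on_frechet)
  obtain r where r: "r > 0" "ball x r \<subseteq> S" using S openE by blast
  show ?thesis
  proof (rule tendstoI)
    fix e :: real assume "e > 0"
    have "isCont ?f2 x"
      using smooth_on_continuous[OF f2] S continuous_on_eq_continuous_at by blast
    then obtain d where d: "d > 0" "\<And>y. dist y x < d \<Longrightarrow> dist (?f2 y) (?f2 x) < e"
      using \<open>e > 0\<close> unfolding continuous_at_eps_delta by blast
    \<comment> \<open>A parallelogram with sides \<open>t v\<close> and \<open>t w\<close> at \<open>x\<close> stays in \<open>S\<close> and within \<open>d\<close> of \<open>x\<close> if \<open>t < m\<close>;
      the summand 1 only avoids a division by zero.\<close>
    define m where "m = min r d / (norm v + norm w + 1)"
    have K: "norm v + norm w + 1 > 0" by (simp add: add_nonneg_pos)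
    have m: "m > 0" using r d K by (simp add: m_def)
    have near: "dist (x + s *\<^sub>R v + s' *\<^sub>R w) x < min r d"
      if "0 \<le> s" "s \<le> t" "0 \<le> s'" "s' \<le> t" "0 < t" "t < m" for s s' t
    proof -
      have "norm (s *\<^sub>R v + s' *\<^sub>R w) \<le> s * norm v + s' * norm w"
        using norm_triangle_ineq[of "s *\<^sub>R v" "s' *\<^sub>R w"] that by simp
      also have "\<dots> \<le> t * norm v + t * norm w"
        using that by (intro add_mono mult_right_mono) auto
      also have "\<dots> < t * (norm v + norm w + 1)" using that by (simp add: algebra_simps)
      also have "\<dots> < min r d" using that K by (simp add: m_def field_simps)
      finally show ?thesis by (simp add: dist_norm add.assoc)
    qed
    have *: "dist ((f (x + t *\<^sub>R v + t *\<^sub>R w) - f (x + t *\<^sub>R v) - f (x + t *\<^sub>R w) + f x) / t\<^sup>2) (?f2 x) < e"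
      if t: "0 < t" "t < m" for t
    proof -
      have inS: "x + s *\<^sub>R v + s' *\<^sub>R w \<in> S" if "0 \<le> s" "s \<le> t" "0 \<le> s'" "s' \<le> t" for s s'
        using near[OF that t] r(2) by (auto simp: dist_commute)
      define \<phi> where "\<phi> s = f (x + s *\<^sub>R v + t *\<^sub>R w) - f (x + s *\<^sub>R v)" for s
      have "\<exists>s>0. s < t \<and> \<phi> t - \<phi> 0 = (t - 0) * (?f1 (x + s *\<^sub>R v + t *\<^sub>R w) - ?f1 (x + s *\<^sub>R v))"
      proof (rule MVT2[OF t(1)])
        fix s assume s: "0 \<le> s" "s \<le> t"
        have "((\<lambda>s. f (x + t *\<^sub>R w + s *\<^sub>R v)) has_real_derivative ?f1 (x + t *\<^sub>R w + s *\<^sub>R v)) (at s)"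
          using smooth_on_has_derivative[OF f inS[of s t]] s t
          by (intro has_real_derivative_along_line) (simp add: algebra_simps)
        moreover have "((\<lambda>s. f (x + s *\<^sub>R v)) has_real_derivative ?f1 (x + s *\<^sub>R v)) (at s)"
          using smooth_on_has_derivative[OF f inS[of s 0]] s t
          by (intro has_real_derivative_along_line) simp
        ultimately show "(\<phi> has_real_derivative ?f1 (x + s *\<^sub>R v + t *\<^sub>R w) - ?f1 (x + s *\<^sub>R v)) (at s)"
          unfolding \<phi>_def using DERIV_diff by (simp add: add.assoc add.commute[of "t *\<^sub>R w"]) blast
      qed
      then obtain s where s: "0 < s" "s < t"
        and phi: "\<phi> t - \<phi> 0 = t * (?f1 (x + s *\<^sub>R v + t *\<^sub>R w) - ?f1 (x + s *\<^sub>R v))" by auto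
      have "\<exists>s'>0. s' < t \<and> ?f1 (x + s *\<^sub>R v + t *\<^sub>R w) - ?f1 (x + s *\<^sub>R v + 0 *\<^sub>R w)
              = (t - 0) * ?f2 (x + s *\<^sub>R v + s' *\<^sub>R w)"
      proof (rule MVT2[OF t(1), of "\<lambda>s'. ?f1 (x + s *\<^sub>R v + s' *\<^sub>R w)"])
        fix s' assume s': "0 \<le> s'" "s' \<le> t"
        show "((\<lambda>s'. ?f1 (x + s *\<^sub>R v + s' *\<^sub>R w)) has_real_derivative ?f2 (x + s *\<^sub>R v + s' *\<^sub>R w)) (at s')"
          using smooth_on_has_derivative[OF f1 inS[of s s']] s s' t
          by (intro has_real_derivative_along_line) simp
      qed
      then obtain s' where s': "0 < s'" "s' < t"
        and psi: "?f1 (x + s *\<^sub>R v + t *\<^sub>R w) - ?f1 (x + s *\<^sub>R v) = t * ?f2 (x + s *\<^sub>R v + s' *\<^sub>R w)"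
        by auto
      have "f (x + t *\<^sub>R v + t *\<^sub>R w) - f (x + t *\<^sub>R v) - f (x + t *\<^sub>R w) + f x = \<phi> t - \<phi> 0"
        by (simp add: \<phi>_def)
      also have "\<dots> = t\<^sup>2 * ?f2 (x + s *\<^sub>R v + s' *\<^sub>R w)"
        using phi psi by (simp add: power2_eq_square)
      finally have "(f (x + t *\<^sub>R v + t *\<^sub>R w) - f (x + t *\<^sub>R v) - f (x + t *\<^sub>R w) + f x) / t\<^sup>2
          = ?f2 (x + s *\<^sub>R v + s' *\<^sub>R w)" using t by simp
      then show ?thesis using near[of s t s'] s s' t d(2) by simp
    qed
    show "\<forall>\<^sub>F t in at_right 0. dist ((f (x + t *\<^sub>R v + t *\<^sub>R w) - f (x + t *\<^sub>R v) - f (x + t *\<^sub>R w) + f x) / t\<^sup>2) (?f2 x) < e"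
      unfolding eventually_at_right_field using * m by (intro exI[of _ m]) auto
  qed
qed

lemma second_derivative_symmetric_real:
  fixes f :: "'x::euclidean_space \<Rightarrow> real"
  assumes "open S" "x \<in> S" "smooth_on f S"
  shows "frechet_derivative (\<lambda>y. frechet_derivative f (at y) v) (at x) w
       = frechet_derivative (\<lambda>y. frechet_derivative f (at y) w) (at x) v"
proof -
  have "(f (x + t *\<^sub>R w + t *\<^sub>R v) - f (x + t *\<^sub>R w) - f (x + t *\<^sub>R v) + f x) / t\<^sup>2
      = (f (x + t *\<^sub>R v + t *\<^sub>R w) - f (x + t *\<^sub>R v) - f (x + t *\<^sub>R w) + f x) / t\<^sup>2" for t
    by (simp add: add.assoc add.commute[of "t *\<^sub>R w" "t *\<^sub>R v"])
  then show ?thesis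
    using second_difference_tendsto[OF assms, of v w] second_difference_tendsto[OF assms, of w v]
    by (metis (no_types, lifting) ext tendsto_unique trivial_limit_at_right_real)
qed

lemma second_derivative_symmetric:
  fixes f :: "'x::euclidean_space \<Rightarrow> 'y::euclidean_space"
  assumes S: "open S" "x \<in> S" and f: "smooth_on f S"
  shows "frechet_derivative (\<lambda>y. frechet_derivative f (at y) v) (at x) w
       = frechet_derivative (\<lambda>y. frechet_derivative f (at y) w) (at x) v"
proof (rule euclidean_eqI)
  fix b :: 'y assume "b \<in> Basis"
  have fb: "frechet_derivative (\<lambda>y. g y \<bullet> b) (at y) u = frechet_derivative g (at y) u \<bullet> b"
    if "smooth_on g S" "y \<in> S" for g :: "'x \<Rightarrow> 'y" and y u
    using frechet_derivative_at[OF has_derivative_inner_left[OF smooth_on_has_derivative[OF that], of b]]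
    by (metis (mono_tags))
  have **: "frechet_derivative (\<lambda>y. frechet_derivative (\<lambda>y. f y \<bullet> b) (at y) v) (at x) w
      = frechet_derivative (\<lambda>y. frechet_derivative f (at y) v) (at x) w \<bullet> b" for v w
  proof -
    have "((\<lambda>y. frechet_derivative f (at y) v \<bullet> b) has_derivative
        (\<lambda>h. frechet_derivative (\<lambda>y. frechet_derivative f (at y) v) (at x) h \<bullet> b)) (at x)"
      by (intro has_derivative_inner_left smooth_on_has_derivative[OF smooth_on_frechet[OF f] S(2)])
    then have "((\<lambda>y. frechet_derivative (\<lambda>y. f y \<bullet> b) (at y) v) has_derivative
        (\<lambda>h. frechet_derivative (\<lambda>y. frechet_derivative f (at y) v) (at x) h \<bullet> b)) (at x)"
      by (rule has_derivative_transform_within_open[OF _ S]) (simp add: fb[OF f])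
    then show ?thesis by (metis frechet_derivative_at)
  qed
  have "smooth_on (\<lambda>y. f y \<bullet> b) S"
    by (rule smooth_on_linear[OF S(1) bounded_linear_inner_left f])
  from second_derivative_symmetric_real[OF S this, of v w]
  show "frechet_derivative (\<lambda>y. frechet_derivative f (at y) v) (at x) w \<bullet> b
      = frechet_derivative (\<lambda>y. frechet_derivative f (at y) w) (at x) v \<bullet> b"
    by (simp add: **)
qed

text \<open>The product rule for the evaluation of a field of linear maps on a vector field, when only the values of the
  linear maps on fixed vectors are known to be differentiable.\<close>

lemma has_derivative_linear_apply:
  fixes A :: "'x::euclidean_space \<Rightarrow> 'y::euclidean_space" and F :: "'x \<Rightarrow> 'y \<Rightarrow> 'z::real_normed_vector"
  assumes S: "open S" "x \<in> S" and lin: "\<And>y. y \<in> S \<Longrightarrow> linear (F y)"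
    and F: "\<And>w. ((\<lambda>y. F y w) has_derivative F' w) (at x)" and A: "(A has_derivative A') (at x)"
  shows "((\<lambda>y. F y (A y)) has_derivative (\<lambda>h. F' (A x) h + F x (A' h))) (at x)"
proof -
  have rep: "F y w = (\<Sum>b\<in>Basis. (w \<bullet> b) *\<^sub>R F y b)" if "y \<in> S" for y w
  proof -
    interpret linear "F y" by (rule lin[OF that])
    have "F y w = F y (\<Sum>b\<in>Basis. (w \<bullet> b) *\<^sub>R b)" by (simp add: euclidean_representation)
    then show ?thesis by (simp add: sum scale)
  qed
  have repF': "F' w h = (\<Sum>b\<in>Basis. (w \<bullet> b) *\<^sub>R F' b h)" for w h
  proof -
    have "((\<lambda>y. \<Sum>b\<in>Basis. (w \<bullet> b) *\<^sub>R F y b) has_derivative (\<lambda>h. \<Sum>b\<in>Basis. (w \<bullet> b) *\<^sub>R F' b h)) (at x)"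
      by (auto intro!: derivative_eq_intros F)
    then have "((\<lambda>y. F y w) has_derivative (\<lambda>h. \<Sum>b\<in>Basis. (w \<bullet> b) *\<^sub>R F' b h)) (at x)"
      by (rule has_derivative_transform_within_open[OF _ S]) (simp add: rep)
    then show ?thesis using F has_derivative_unique by metis
  qed
  have "((\<lambda>y. \<Sum>b\<in>Basis. (A y \<bullet> b) *\<^sub>R F y b) has_derivative
      (\<lambda>h. \<Sum>b\<in>Basis. (A x \<bullet> b) *\<^sub>R F' b h + (A' h \<bullet> b) *\<^sub>R F x b)) (at x)"
    by (auto intro!: derivative_eq_intros F A)
  then have "((\<lambda>y. F y (A y)) has_derivative
      (\<lambda>h. \<Sum>b\<in>Basis. (A x \<bullet> b) *\<^sub>R F' b h + (A' h \<bullet> b) *\<^sub>R F x b)) (at x)"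
    by (rule has_derivative_transform_within_open[OF _ S]) (simp add: rep[symmetric])
  moreover have "(\<Sum>b\<in>Basis. (A x \<bullet> b) *\<^sub>R F' b h + (A' h \<bullet> b) *\<^sub>R F x b) = F' (A x) h + F x (A' h)" for h
    by (subst repF'[of "A x"], subst rep[OF S(2), of "A' h"], simp add: sum.distrib)
  ultimately show ?thesis by simp
qed

text \<open>The identity \<open>d(d\<alpha>) = 0\<close> for a 1-form on an open set, evaluated on constant fields.\<close>

lemma exterior_derivative_closed:
  fixes \<alpha> :: "'x::euclidean_space \<Rightarrow> 'x \<Rightarrow> real"
  assumes S: "open S" "x \<in> S" and sm: "\<And>w. smooth_on (\<lambda>y. \<alpha> y w) S"
  defines "\<beta> \<equiv> \<lambda>y a b. frechet_derivative (\<lambda>y. \<alpha> y b) (at y) a - frechet_derivative (\<lambda>y. \<alpha> y a) (at y) b"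
  shows "frechet_derivative (\<lambda>y. \<beta> y b c) (at x) a + frechet_derivative (\<lambda>y. \<beta> y c a) (at x) b
       + frechet_derivative (\<lambda>y. \<beta> y a b) (at x) c = 0"
proof -
  let ?D = "\<lambda>a b c. frechet_derivative (\<lambda>y. frechet_derivative (\<lambda>y. \<alpha> y c) (at y) b) (at x) a"
  have *: "frechet_derivative (\<lambda>y. \<beta> y b c) (at x) a = ?D a b c - ?D a c b" for a b c
    unfolding \<beta>_def
    by (rule fun_cong[OF frechet_derivative_at[symmetric]])
      (intro has_derivative_diff smooth_on_has_derivative[OF smooth_on_frechet[OF sm] S(2)])
  have "?D a b c = ?D b a c" for a b c
    by (rule second_derivative_symmetric_real[OF S sm])
  then show ?thesis by (simp add: *)
qed

section \<open>Charts and coordinate fields\<close>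

lemma smooth_atlasD:
  assumes "smooth_atlas A"
  shows smooth_atlas_cover: "(\<Union>c\<in>A. fst c) = UNIV"
    and smooth_atlas_open: "c \<in> A \<Longrightarrow> open (fst c)"
    and smooth_atlas_open_image: "c \<in> A \<Longrightarrow> open (snd c ` fst c)"
    and smooth_atlas_homeomorphism: "c \<in> A \<Longrightarrow> homeomorphism (fst c) (snd c ` fst c) (snd c) (param c)"
    and smooth_atlas_transition:
      "c \<in> A \<Longrightarrow> d \<in> A \<Longrightarrow> smooth_on (snd d \<circ> param c) (snd c ` (fst c \<inter> fst d))"
  using assms by (auto simp: smooth_atlas_def)

lemma chart_at:
  assumes "smooth_atlas A"
  shows "chart_at A p \<in> A" "p \<in> fst (chart_at A p)"
proof -
  have "\<exists>c. c \<in> A \<and> p \<in> fst c" using smooth_atlas_cover[OF assms] by blast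
  then have "chart_at A p \<in> A \<and> p \<in> fst (chart_at A p)"
    unfolding chart_at_def by (rule someI_ex)
  then show "chart_at A p \<in> A" "p \<in> fst (chart_at A p)" by auto
qed

lemma param_chart: "smooth_atlas A \<Longrightarrow> c \<in> A \<Longrightarrow> p \<in> fst c \<Longrightarrow> param c (snd c p) = p"
  using smooth_atlas_homeomorphism homeomorphism_apply1 by blast

lemma chart_image_open:
  assumes A: "smooth_atlas A" "c \<in> A" "open W"
  shows "open (snd c ` (fst c \<inter> W))"
proof -
  have "openin (top_of_set (snd c ` fst c)) (snd c ` (fst c \<inter> W))"
    by (rule homeomorphism_imp_open_map[OF smooth_atlas_homeomorphism[OF A(1,2)]])
      (use A in \<open>auto intro: openin_open_Int\<close>)
  then show ?thesis using smooth_atlas_open_image[OF A(1,2)] openin_open_trans by blast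
qed

lemma transition_has_derivative:
  assumes A: "smooth_atlas A" "c \<in> A" "d \<in> A" and p: "p \<in> fst c" "p \<in> fst d"
  shows "((snd d \<circ> param c) has_derivative tchange c d p) (at (snd c p))"
  unfolding tchange_def
  using smooth_on_has_derivative[OF smooth_atlas_transition[OF A]] p by auto

lemma tchange_linear:
  "smooth_atlas A \<Longrightarrow> c \<in> A \<Longrightarrow> d \<in> A \<Longrightarrow> p \<in> fst c \<Longrightarrow> p \<in> fst d \<Longrightarrow> linear (tchange c d p)"
  using transition_has_derivative has_derivative_linear by blast

lemma chart_nbhd:
  assumes A: "smooth_atlas A" "c \<in> A" and "open W" "p \<in> fst c" "p \<in> W"
  shows "open (snd c ` (fst c \<inter> W))" "snd c p \<in> snd c ` (fst c \<inter> W)"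
  using chart_image_open[OF A assms(3)] assms by auto

lemma tchange_comp:
  assumes A: "smooth_atlas A" "c \<in> A" "d \<in> A" "e \<in> A" and p: "p \<in> fst c" "p \<in> fst d" "p \<in> fst e"
  shows "tchange d e p (tchange c d p v) = tchange c e p v"
proof -
  have d: "(snd d \<circ> param c) (snd c p) = snd d p" using param_chart[OF A(1,2) p(1)] by simp
  have "((snd e \<circ> param d) \<circ> (snd d \<circ> param c) has_derivative tchange d e p \<circ> tchange c d p) (at (snd c p))"
    using diff_chain_at[OF transition_has_derivative[OF A(1,2,3) p(1,2)], of "snd e \<circ> param d" "tchange d e p"]
      transition_has_derivative[OF A(1,3,4) p(2,3)] d by simp
  then have "((snd e \<circ> param c) has_derivative tchange d e p \<circ> tchange c d p) (at (snd c p))"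
    by (rule has_derivative_transform_within_open[OF _ chart_nbhd[OF A(1,2) smooth_atlas_open[OF A(1,3)] p(1,2)]])
      (auto simp: param_chart[OF A(1)] A)
  then have "tchange d e p \<circ> tchange c d p = tchange c e p"
    using transition_has_derivative[OF A(1,2,4) p(1,3)] has_derivative_unique by blast
  then show ?thesis by (metis comp_apply)
qed

lemma tchange_self:
  assumes A: "smooth_atlas A" "c \<in> A" and p: "p \<in> fst c"
  shows "tchange c c p v = v"
proof -
  have "((\<lambda>x. x) has_derivative tchange c c p) (at (snd c p))"
    by (rule has_derivative_transform_within_open[OF transition_has_derivative[OF A A(2) p p]
          smooth_atlas_open_image[OF A]]) (use p in \<open>auto simp: param_chart[OF A]\<close>)
  then have "tchange c c p = (\<lambda>x. x)" using has_derivative_unique has_derivative_ident by blast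
  then show ?thesis by simp
qed

lemma tcomp_cfield:
  "smooth_atlas A \<Longrightarrow> c \<in> A \<Longrightarrow> d \<in> A \<Longrightarrow> p \<in> fst c \<Longrightarrow> p \<in> fst d \<Longrightarrow>
     tcomp A d p (cfield A c w p) = tchange c d p w"
  unfolding tcomp_def cfield_def by (rule tchange_comp) (auto simp: chart_at)

lemma tcomp_cfield_self:
  "smooth_atlas A \<Longrightarrow> c \<in> A \<Longrightarrow> p \<in> fst c \<Longrightarrow> tcomp A c p (cfield A c w p) = w"
  by (simp add: tcomp_cfield tchange_self)

lemma cfield_tcomp:
  "smooth_atlas A \<Longrightarrow> c \<in> A \<Longrightarrow> p \<in> fst c \<Longrightarrow> cfield A c (tcomp A c p v) p = v"
  unfolding tcomp_def cfield_def by (simp add: tchange_comp[where p = p] chart_at tchange_self)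

lemma tcomp_chart_at: "smooth_atlas A \<Longrightarrow> tcomp A (chart_at A p) p v = v"
  unfolding tcomp_def by (simp add: chart_at tchange_self)

lemma cfield_chart_at: "smooth_atlas A \<Longrightarrow> cfield A (chart_at A p) w p = w"
  unfolding cfield_def by (simp add: chart_at tchange_self)

lemma linear_tcomp: "smooth_atlas A \<Longrightarrow> c \<in> A \<Longrightarrow> p \<in> fst c \<Longrightarrow> linear (tcomp A c p)"
  unfolding tcomp_def using tchange_linear chart_at by blast

lemma linear_cfield: "smooth_atlas A \<Longrightarrow> c \<in> A \<Longrightarrow> p \<in> fst c \<Longrightarrow> linear (\<lambda>w. cfield A c w p)"
  unfolding cfield_def using tchange_linear chart_at by blast

lemma smooth_vf_subset: "smooth_vf A W X \<Longrightarrow> W' \<subseteq> W \<Longrightarrow> smooth_vf A W' X"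
  unfolding smooth_vf_def by (blast intro: smooth_on_subset)

lemma smooth_vf_cfield:
  assumes A: "smooth_atlas A" "d \<in> A"
  shows "smooth_vf A (fst d) (cfield A d w)"
  unfolding smooth_vf_def
proof
  fix c assume c: "c \<in> A"
  let ?S = "snd c ` (fst c \<inter> fst d)" and ?T = "snd d ` (fst d \<inter> fst c)"
  have S: "open ?S" "open ?T"
    using chart_image_open A c smooth_atlas_open by blast+
  have im: "(snd d \<circ> param c) ` ?S \<subseteq> ?T" by (auto simp: param_chart[OF A(1) c])
  have "smooth_on ((\<lambda>y. frechet_derivative (snd c \<circ> param d) (at y) w) \<circ> (snd d \<circ> param c)) ?S"
    by (rule smooth_on_compose[OF S im smooth_on_frechet[OF smooth_atlas_transition[OF A c]]
          smooth_atlas_transition[OF A(1) c A(2)]])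
  then show "smooth_on (\<lambda>x. tcomp A c (param c x) (cfield A d w (param c x))) ?S"
    by (rule smooth_on_cong[OF S(1)])
      (auto simp: param_chart[OF A(1) c] tcomp_cfield A c tchange_def)
qed

lemma smooth_vf_chart_derivative:
  assumes A: "smooth_atlas A" "d \<in> A" and W: "smooth_vf A W X" "p \<in> fst d" "p \<in> W"
  shows "((\<lambda>x. tcomp A d (param d x) (X (param d x))) has_derivative
     frechet_derivative (\<lambda>x. tcomp A d (param d x) (X (param d x))) (at (snd d p))) (at (snd d p))"
  by (rule smooth_on_has_derivative[of _ "snd d ` (fst d \<inter> W)"]) (use assms in \<open>auto simp: smooth_vf_def\<close>)

lemma smooth_fun_chart_derivative:
  assumes A: "d \<in> A" and W: "smooth_fun A W h" "p \<in> fst d" "p \<in> W"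
  shows "((h \<circ> param d) has_derivative frechet_derivative (h \<circ> param d) (at (snd d p))) (at (snd d p))"
  by (rule smooth_on_has_derivative[of _ "snd d ` (fst d \<inter> W)"]) (use assms in \<open>auto simp: smooth_fun_def\<close>)

lemma dfun_in_chart:
  assumes A: "smooth_atlas A" "d \<in> A" and h: "smooth_fun A W h" "p \<in> fst d" "p \<in> W"
  shows "dfun A h p v = frechet_derivative (h \<circ> param d) (at (snd d p)) (tcomp A d p v)"
proof -
  let ?c = "chart_at A p"
  note c = chart_at[OF A(1), of p]
  have "((h \<circ> param d) \<circ> (snd d \<circ> param ?c) has_derivative
      frechet_derivative (h \<circ> param d) (at (snd d p)) \<circ> tchange ?c d p) (at (snd ?c p))"
    using diff_chain_at[OF transition_has_derivative[OF A(1) c(1) A(2) c(2) h(2)], of "h \<circ> param d"]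
      smooth_fun_chart_derivative[OF A(2) h] param_chart[OF A(1) c] by simp
  then have "((h \<circ> param ?c) has_derivative
      frechet_derivative (h \<circ> param d) (at (snd d p)) \<circ> tchange ?c d p) (at (snd ?c p))"
    by (rule has_derivative_transform_within_open[OF _
          chart_nbhd[OF A(1) c(1) smooth_atlas_open[OF A] c(2) h(2)]])
      (auto simp: param_chart[OF A(1)] c A)
  then show ?thesis unfolding dfun_def tcomp_def by (metis comp_apply frechet_derivative_at)
qed

text \<open>The bracket at \<open>p\<close> is computed in \<open>chart_at A p\<close>, in which the coordinate fields of \<open>d\<close> are the columns of the
  derivative of the transition map \<open>T\<close>. Their mutual derivatives are the second derivatives of \<open>T\<close>, which are
  symmetric.\<close>

lemma lie_bracket_cfield:
  assumes A: "smooth_atlas A" "d \<in> A" and p: "p \<in> fst d"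
  shows "lie_bracket A (cfield A d a) (cfield A d b) p = 0"
proof -
  let ?c = "chart_at A p"
  note c = chart_at[OF A(1), of p]
  define T where "T = snd ?c \<circ> param d"
  have D: "frechet_derivative (\<lambda>x. tcomp A ?c (param ?c x) (cfield A d w (param ?c x))) (at (snd ?c p)) (cfield A d z p)
      = frechet_derivative (\<lambda>y. frechet_derivative T (at y) w) (at (snd d p)) z" for w z
  proof -
    let ?f = "\<lambda>y. frechet_derivative T (at y) w"
    have "(?f has_derivative frechet_derivative ?f (at (snd d p))) (at (snd d p))"
      by (rule smooth_on_has_derivative[OF smooth_on_frechet[OF
            smooth_atlas_transition[OF A c(1), folded T_def]]]) (use p c in auto)
    then have "(?f \<circ> (snd d \<circ> param ?c) has_derivative
        frechet_derivative ?f (at (snd d p)) \<circ> tchange ?c d p) (at (snd ?c p))"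
      using diff_chain_at[OF transition_has_derivative[OF A(1) c(1) A(2) c(2) p], of ?f]
        param_chart[OF A(1) c] by simp
    then have "((\<lambda>x. tcomp A ?c (param ?c x) (cfield A d w (param ?c x))) has_derivative
        frechet_derivative ?f (at (snd d p)) \<circ> tchange ?c d p) (at (snd ?c p))"
      by (rule has_derivative_transform_within_open[OF _
          chart_nbhd[OF A(1) c(1) smooth_atlas_open[OF A] c(2) p]])
        (auto simp: param_chart[OF A(1)] tcomp_cfield c A tchange_def T_def)
    then have "frechet_derivative (\<lambda>x. tcomp A ?c (param ?c x) (cfield A d w (param ?c x))) (at (snd ?c p))
        = frechet_derivative ?f (at (snd d p)) \<circ> tchange ?c d p"
      by (rule frechet_derivative_at[symmetric])
    then show ?thesis
      unfolding cfield_def by (simp add: tchange_comp[OF A(1,2) c(1) A(2) p c(2) p] tchange_self[OF A p])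
  qed
  have "smooth_on T (snd d ` (fst d \<inter> fst ?c))"
    unfolding T_def by (rule smooth_atlas_transition[OF A c(1)])
  from second_derivative_symmetric[OF chart_nbhd[OF A smooth_atlas_open[OF A(1) c(1)] p c(2)] this, of a b]
  show ?thesis unfolding lie_bracket_def Let_def D by simp
qed

text \<open>Umbilicity and conformality are conditions on coordinate neighbourhoods; this lemma provides arbitrarily small ones.\<close>

lemma smooth_atlas_restrict_chart:
  assumes A: "smooth_atlas A" "c \<in> A" "open W"
  shows "smooth_atlas (insert (fst c \<inter> W, snd c) A)"
proof -
  let ?r = "(fst c \<inter> W, snd c)"
  have sub: "\<exists>d\<in>A. fst e \<subseteq> fst d \<and> snd e = snd d \<and> (\<forall>p\<in>fst e. param e (snd e p) = p)
      \<and> open (fst e)" if "e \<in> insert ?r A" for e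
  proof (cases "e \<in> A")
    case True
    then show ?thesis using param_chart[OF A(1)] smooth_atlas_open[OF A(1)] by blast
  next
    case False
    have "inj_on (snd c) (fst c)" using param_chart[OF A(1,2)] by (metis inj_onI)
    then have "inj_on (snd c) (fst c \<inter> W)" by (rule inj_on_subset) auto
    then have "param ?r (snd c p) = p" if "p \<in> fst c \<inter> W" for p
      using that by (simp add: param_def)
    then show ?thesis using False that A smooth_atlas_open[OF A(1,2)] by (intro bexI[of _ c]) auto
  qed
  have op: "open (snd e ` (fst e \<inter> V))" if e: "e \<in> insert ?r A" and V: "open V" for e V
  proof -
    obtain d where d: "d \<in> A" "fst e \<subseteq> fst d" "snd e = snd d" "open (fst e)"
      using sub[OF e] by blast
    have "open (snd d ` (fst d \<inter> (fst e \<inter> V)))" using chart_image_open[OF A(1) d(1)] d(4) V by blast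
    moreover have "fst d \<inter> (fst e \<inter> V) = fst e \<inter> V" using d by auto
    ultimately show ?thesis using d by simp
  qed
  have hom: "homeomorphism (fst e) (snd e ` fst e) (snd e) (param e)" if e: "e \<in> insert ?r A" for e
  proof -
    obtain d where d: "d \<in> A" "fst e \<subseteq> fst d" "snd e = snd d" "\<forall>p\<in>fst e. param e (snd e p) = p"
      using sub[OF e] by blast
    have "homeomorphism (fst e) (snd d ` fst e) (snd d) (param d)"
      by (rule homeomorphism_of_subsets[OF smooth_atlas_homeomorphism[OF A(1) d(1)] d(2) subset_refl])
        (use d in auto)
    then show ?thesis
      by (rule homeomorphism_cong) (use d param_chart[OF A(1) d(1)] in auto)
  qed
  have tr: "smooth_on (snd e' \<circ> param e) (snd e ` (fst e \<inter> fst e'))"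
    if e: "e \<in> insert ?r A" and e': "e' \<in> insert ?r A" for e e'
  proof -
    obtain d where d: "d \<in> A" "fst e \<subseteq> fst d" "snd e = snd d" "\<forall>p\<in>fst e. param e (snd e p) = p"
      using sub[OF e] by blast
    obtain d' where d': "d' \<in> A" "fst e' \<subseteq> fst d'" "snd e' = snd d'" "open (fst e')"
      using sub[OF e'] by blast
    have "smooth_on (snd d' \<circ> param d) (snd e ` (fst e \<inter> fst e'))"
      by (rule smooth_on_subset[OF smooth_atlas_transition[OF A(1) d(1) d'(1)]]) (use d d' in auto)
    then show ?thesis
      by (rule smooth_on_cong[OF op[OF e d'(4)]]) (use d d' param_chart[OF A(1) d(1)] in auto)
  qed
  show ?thesis
    unfolding smooth_atlas_def
  proof (intro conjI ballI)
    show "(\<Union>c\<in>insert ?r A. fst c) = UNIV" using smooth_atlas_cover[OF A(1)] by auto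
    show "open (fst e)" "open (snd e ` fst e)" if "e \<in> insert ?r A" for e
      using sub[OF that] op[OF that, of UNIV] by auto
  qed (use hom tr in auto)
qed

section \<open>The Levi-Civita connection in a chart\<close>

locale semi_riemannian_manifold =
  fixes M :: "('a::topological_space, 'e::euclidean_space) ambient" and r :: nat
  assumes atlas: "smooth_atlas (atlas M)" and metric: "semi_riemannian r M" and lc: "levi_civita M"
begin

lemma metric_bilinear: "bilinear (metric M p)"
  and metric_sym: "metric M p x y = metric M p y x"
  and metric_nondegenerate: "(\<And>w. metric M p x w = 0) \<Longrightarrow> x = 0"
  using metric unfolding semi_riemannian_def by blast+

lemma smooth_metric:
  "open W \<Longrightarrow> smooth_vf (atlas M) W X \<Longrightarrow> smooth_vf (atlas M) W Y \<Longrightarrow>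
     smooth_fun (atlas M) W (\<lambda>p. metric M p (X p) (Y p))"
  using metric unfolding semi_riemannian_def by blast

lemmas metric_simps =
  bilinear_ladd[OF metric_bilinear] bilinear_radd[OF metric_bilinear]
  bilinear_lsub[OF metric_bilinear] bilinear_rsub[OF metric_bilinear]
  bilinear_lneg[OF metric_bilinear] bilinear_rneg[OF metric_bilinear]
  bilinear_lmul[OF metric_bilinear] bilinear_rmul[OF metric_bilinear]
  bilinear_lzero[OF metric_bilinear] bilinear_rzero[OF metric_bilinear]

lemma metric_eqI: "(\<And>w. metric M p x w = metric M p y w) \<Longrightarrow> x = y"
  using metric_nondegenerate[of p "x - y"] by (simp add: metric_simps)

lemma smooth_cfield: "smooth_vf (atlas M) (fst (chart_at (atlas M) p) \<inter> W) (cfield (atlas M) (chart_at (atlas M) p) w)"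
  by (rule smooth_vf_subset[OF smooth_vf_cfield[OF atlas]]) (auto simp: chart_at[OF atlas])

lemma open_chart: "open W \<Longrightarrow> open (fst (chart_at (atlas M) p) \<inter> W)"
  using smooth_atlas_open[OF atlas chart_at(1)[OF atlas]] by blast

lemma torsion_free:
  assumes "open W" "p \<in> W" "smooth_vf (atlas M) W X" "smooth_vf (atlas M) W Y"
  shows "conn M p (X p) Y - conn M p (Y p) X = lie_bracket (atlas M) X Y p"
  using lc assms unfolding levi_civita_def by blast

lemma metric_compatible:
  assumes W: "open W" "p \<in> W" and Y: "smooth_vf (atlas M) W Y" and Z: "smooth_vf (atlas M) W Z"
  shows "dfun (atlas M) (\<lambda>q. metric M q (Y q) (Z q)) p v
       = metric M p (conn M p v Y) (Z p) + metric M p (Y p) (conn M p v Z)"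
proof -
  let ?d = "chart_at (atlas M) p" let ?W = "fst ?d \<inter> W"
  have "open ?W" "p \<in> ?W" "smooth_vf (atlas M) ?W Y" "smooth_vf (atlas M) ?W Z"
    using W Y Z chart_at(2)[OF atlas] by (auto intro: smooth_vf_subset open_chart)
  then have "dfun (atlas M) (\<lambda>q. metric M q (Y q) (Z q)) p (cfield (atlas M) ?d v p)
       = metric M p (conn M p (cfield (atlas M) ?d v p) Y) (Z p)
         + metric M p (Y p) (conn M p (cfield (atlas M) ?d v p) Z)"
    using lc smooth_cfield[of p W v] unfolding levi_civita_def by blast
  then show ?thesis by (simp add: cfield_chart_at[OF atlas])
qed

lemma conn_smooth:
  "open W \<Longrightarrow> smooth_vf (atlas M) W X \<Longrightarrow> smooth_vf (atlas M) W Y \<Longrightarrow>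
     smooth_vf (atlas M) W (\<lambda>p. conn M p (X p) Y)"
  using lc smooth_metric[of W X X] unfolding levi_civita_def affine_connection_def by blast

lemma conn_linear: "open W \<Longrightarrow> p \<in> W \<Longrightarrow> smooth_vf (atlas M) W Y \<Longrightarrow> linear (\<lambda>v. conn M p v Y)"
  using lc smooth_metric[of W Y Y] unfolding levi_civita_def affine_connection_def by blast

end

text \<open>The derivative at \<open>p\<close> of the components of \<open>Y\<close> in the chart \<open>chart_at A p\<close>; the part of the covariant derivative
  that is free of Christoffel symbols.\<close>

definition field_deriv :: "('a, 'e::euclidean_space) chart set \<Rightarrow> 'a \<Rightarrow> ('a \<Rightarrow> 'e) \<Rightarrow> 'e \<Rightarrow> 'e" where
  "field_deriv A p Y v = frechet_derivative
     (\<lambda>x. tcomp A (chart_at A p) (param (chart_at A p) x) (Y (param (chart_at A p) x)))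
     (at (snd (chart_at A p) p)) v"

lemma lie_bracket_field_deriv:
  "lie_bracket A X Y p = field_deriv A p Y (X p) - field_deriv A p X (Y p)"
  by (simp add: lie_bracket_def field_deriv_def Let_def)

lemma field_deriv_cfield:
  assumes A: "smooth_atlas A"
  shows "field_deriv A p (cfield A (chart_at A p) w) v = 0"
proof -
  let ?d = "chart_at A p"
  have "((\<lambda>x. tcomp A ?d (param ?d x) (cfield A ?d w (param ?d x))) has_derivative (\<lambda>_. 0)) (at (snd ?d p))"
    by (rule has_derivative_transform_within_open[OF has_derivative_const[of w]
          smooth_atlas_open_image[OF A chart_at(1)[OF A]]])
      (auto simp: chart_at[OF A] param_chart[OF A chart_at(1)[OF A]] tcomp_cfield_self[OF A])
  from frechet_derivative_at[OF this] show ?thesis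
    unfolding field_deriv_def by metis
qed

lemma dfun_cong:
  assumes A: "smooth_atlas A" and W: "open W" "p \<in> W" and "smooth_fun A W h" "\<And>q. q \<in> W \<Longrightarrow> h q = h' q"
  shows "dfun A h' p v = dfun A h p v"
proof -
  let ?d = "chart_at A p"
  note d = chart_at[OF A, of p]
  have "((h' \<circ> param ?d) has_derivative frechet_derivative (h \<circ> param ?d) (at (snd ?d p))) (at (snd ?d p))"
    by (rule has_derivative_transform_within_open[OF smooth_fun_chart_derivative[OF d(1) assms(4) d(2) W(2)]
          chart_nbhd[OF A d(1) W(1) d(2) W(2)]])
      (use assms(5) in \<open>auto simp: param_chart[OF A d(1)]\<close>)
  then show ?thesis unfolding dfun_def by (metis frechet_derivative_at)
qed

lemma dfun_minus:
  assumes A: "smooth_atlas A" and W: "p \<in> W" and h: "smooth_fun A W h"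
  shows "dfun A (\<lambda>q. - h q) p v = - dfun A h p v"
proof -
  let ?d = "chart_at A p"
  have "((\<lambda>x. - ((h \<circ> param ?d) x)) has_derivative
      (\<lambda>v. - frechet_derivative (h \<circ> param ?d) (at (snd ?d p)) v)) (at (snd ?d p))"
    by (intro has_derivative_minus smooth_fun_chart_derivative[OF chart_at(1)[OF A] h chart_at(2)[OF A] W])
  from frechet_derivative_at[OF this] show ?thesis
    unfolding dfun_def by (simp add: o_def) metis
qed

context semi_riemannian_manifold begin

text \<open>Freezing the components of \<open>Y\<close> separates the derivative of \<open>g(Y, Z)\<close> into the derivative of the components of \<open>Y\<close> and the
  derivative of everything else.\<close>

lemma dfun_metric_chart:
  assumes W: "open W" "p \<in> W" and Y: "smooth_vf (atlas M) W Y" and Z: "smooth_vf (atlas M) W Z"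
  shows "dfun (atlas M) (\<lambda>q. metric M q (Y q) (Z q)) p v
       = dfun (atlas M) (\<lambda>q. metric M q (cfield (atlas M) (chart_at (atlas M) p) (Y p) q) (Z q)) p v
         + metric M p (field_deriv (atlas M) p Y v) (Z p)"
proof -
  let ?A = "atlas M" let ?d = "chart_at ?A p" let ?cf = "cfield ?A ?d"
  let ?x = "snd ?d p" let ?S = "snd ?d ` (fst ?d \<inter> W)"
  let ?Y = "\<lambda>x. tcomp ?A ?d (param ?d x) (Y (param ?d x))"
  let ?F = "\<lambda>x w. metric M (param ?d x) (?cf w (param ?d x)) (Z (param ?d x))"
  note d = chart_at[OF atlas, of p]
  have S: "open ?S" "?x \<in> ?S" using chart_nbhd[OF atlas d(1) W(1) d(2) W(2)] by auto
  have par: "param ?d (snd ?d q) = q" if "q \<in> fst ?d" for q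
    using param_chart[OF atlas d(1) that] .
  have Yp: "?Y ?x = Y p" by (simp add: par[OF d(2)] tcomp_chart_at[OF atlas])
  have dF: "((\<lambda>y. ?F y w) has_derivative frechet_derivative (\<lambda>y. ?F y w) (at ?x)) (at ?x)" for w
  proof -
    have "smooth_fun ?A (fst ?d \<inter> W) (\<lambda>q. metric M q (?cf w q) (Z q))"
      using Z by (intro smooth_metric open_chart W smooth_cfield) (auto intro: smooth_vf_subset)
    from smooth_fun_chart_derivative[OF d(1) this d(2)] show ?thesis using d(2) W(2) by (simp add: o_def)
  qed
  have dY: "(?Y has_derivative frechet_derivative ?Y (at ?x)) (at ?x)"
    by (rule smooth_vf_chart_derivative[OF atlas d(1) Y d(2) W(2)])
  have "((\<lambda>y. ?F y (?Y y)) has_derivative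
      (\<lambda>h. frechet_derivative (\<lambda>y. ?F y (?Y ?x)) (at ?x) h + ?F ?x (frechet_derivative ?Y (at ?x) h))) (at ?x)"
  proof (rule has_derivative_linear_apply[OF S _ dF dY])
    fix y assume "y \<in> ?S"
    then have y: "param ?d y \<in> fst ?d" using par by auto
    show "linear (?F y)"
      using linear_compose[OF linear_cfield[OF atlas d(1) y], of "\<lambda>x. metric M (param ?d y) x (Z (param ?d y))"]
        metric_bilinear by (simp add: o_def bilinear_def)
  qed
  then have "(((\<lambda>q. metric M q (Y q) (Z q)) \<circ> param ?d) has_derivative
      (\<lambda>h. frechet_derivative (\<lambda>y. ?F y (Y p)) (at ?x) h + ?F ?x (frechet_derivative ?Y (at ?x) h))) (at ?x)"
    unfolding Yp
    by (rule has_derivative_transform_within_open[OF _ S])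
      (auto simp: par cfield_tcomp[OF atlas d(1)])
  from frechet_derivative_at[OF this]
  show ?thesis
    unfolding dfun_def field_deriv_def o_def
    by (metis (no_types, lifting) par d(2) cfield_chart_at[OF atlas])
qed

text \<open>The definition of the pull-back connection along an immersion uses the right-hand side. Both sides have the same
  inner product with every coordinate field \<open>Z\<close>: metric compatibility is applied to \<open>Y, Z\<close> and to the coordinate field
  with the value of \<open>Y\<close>, together with \<open>Z\<close>.\<close>

lemma conn_in_chart:
  assumes W: "open W" "p \<in> W" and Y: "smooth_vf (atlas M) W Y"
  shows "conn M p v Y = field_deriv (atlas M) p Y v
           + conn M p v (cfield (atlas M) (chart_at (atlas M) p) (Y p))"
proof (rule metric_eqI)
  fix z
  let ?cf = "cfield (atlas M) (chart_at (atlas M) p)"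
  let ?W = "fst (chart_at (atlas M) p) \<inter> W"
  have W': "open ?W" "p \<in> ?W" "smooth_vf (atlas M) ?W Y"
    using W Y chart_at(2)[OF atlas] by (auto intro: smooth_vf_subset open_chart)
  show "metric M p (conn M p v Y) z
      = metric M p (field_deriv (atlas M) p Y v + conn M p v (?cf (Y p))) z"
    using dfun_metric_chart[OF W' smooth_cfield[of p W z], of v]
      metric_compatible[OF W' smooth_cfield[of p W z], of v]
      metric_compatible[OF W'(1,2) smooth_cfield[of p W "Y p"] smooth_cfield[of p W z], of v]
    by (simp add: cfield_chart_at[OF atlas] metric_simps)
qed

end


section \<open>The complex structure in a chart\<close>

lemma holomorphic_cfield_J:
  assumes A: "holomorphic_atlas A" "d \<in> A" and q: "q \<in> fst d"
  shows "cfield A d (J w) q = J (cfield A d w q)"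
proof -
  have sA: "smooth_atlas A" using A(1) by (simp add: holomorphic_atlas_def)
  note c = chart_at[OF sA, of q]
  have "holo_map_on (snd (chart_at A q) \<circ> param d) (snd d ` (fst d \<inter> fst (chart_at A q)))"
    using A c unfolding holomorphic_atlas_def by blast
  then obtain D where D: "((snd (chart_at A q) \<circ> param d) has_derivative D) (at (snd d q))"
    and J: "\<And>v. D (J v) = J (D v)"
    using q c unfolding holo_map_on_def by blast
  have "D = tchange d (chart_at A q) q"
    using D transition_has_derivative[OF sA A(2) c(1) q c(2)] has_derivative_unique by blast
  then show ?thesis using J by (simp add: cfield_def)
qed

lemma linear_J: "linear (J :: complex ^ 'k \<Rightarrow> complex ^ 'k)"
  by (rule linearI) (simp_all add: J_def vec_eq_iff algebra_simps scaleR_conv_of_real)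

lemma J_J: "J (J x) = - x"
  by (simp add: J_def vec_eq_iff)

lemma holomorphic_tcomp_J:
  assumes A: "holomorphic_atlas A" "d \<in> A" and q: "q \<in> fst d"
  shows "tcomp A d q (J w) = J (tcomp A d q w)"
proof -
  have sA: "smooth_atlas A" using A(1) by (simp add: holomorphic_atlas_def)
  have "J w = cfield A d (J (tcomp A d q w)) q"
    using holomorphic_cfield_J[OF A q] cfield_tcomp[OF sA A(2) q] by simp
  then show ?thesis using tcomp_cfield_self[OF sA A(2) q] by simp
qed

section \<open>The derivative of the characteristic field on a normal contact manifold\<close>

text \<open>The computations below take place at one fixed point, in the chart \<open>chart_at\<close> of this point.\<close>

locale normal_contact_point =
  fixes n q :: nat and M :: "('a::{t2_space, second_countable_topology}, complex ^ 'k) ambient"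
    and \<C> :: "('a, complex ^ 'k) patch set" and c :: "('a, complex ^ 'k) patch" and p :: 'a
  assumes contact: "indefinite_complex_contact n q M \<C>" and normal: "normal_contact M \<C>"
    and c: "c \<in> \<C>" and p: "p \<in> pdom c"
begin

lemma holomorphic: "holomorphic_atlas (atlas M)"
  and patch: "contact_patch n M c"
  and hermitian: "metric M y (J x) (J z) = metric M y x z"
  using contact c unfolding indefinite_complex_contact_def by blast+

sublocale semi_riemannian_manifold M "4 * q"
proof
  show "smooth_atlas (atlas M)" using holomorphic unfolding holomorphic_atlas_def by blast
  show "semi_riemannian (4 * q) M"
    using contact unfolding indefinite_complex_contact_def by (elim conjE)
  show "levi_civita M"
    using contact unfolding indefinite_complex_contact_def by (elim conjE)
qed

lemma open_pdom: "open (pdom c)"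
proof -
  have "holo_coord_nbhd (atlas M) (pdom c)"
    using patch unfolding contact_patch_def by (rule conjunct1)
  then obtain \<phi> where "holomorphic_atlas (insert (pdom c, \<phi>) (atlas M))"
    unfolding holo_coord_nbhd_def by (rule exE)
  then show ?thesis unfolding holomorphic_atlas_def smooth_atlas_def by auto
qed

lemma smooth_u: "smooth_form (atlas M) (pdom c) (formu c)"
  using patch unfolding contact_patch_def by (elim conjE)

lemma smooth_U: "smooth_vf (atlas M) (pdom c) (vecU c)"
  using patch unfolding contact_patch_def by (elim conjE)

lemma smooth_G: "smooth_endo (atlas M) (pdom c) (tenG c)"
  using patch unfolding contact_patch_def by (elim conjE)

lemma patch_algebra:
  "\<forall>p\<in>pdom c.
        formu c p (vecU c p) = 1 \<and>
        metric M p (vecU c p) (vecV c p) = 0 \<and>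
        tenG c p (vecU c p) = 0 \<and>
        (\<forall>x. metric M p (vecU c p) x = formu c p x \<and>
             tenG c p (tenG c p x) = - x + formu c p x *\<^sub>R vecU c p + formv c p x *\<^sub>R vecV c p \<and>
             tenH c p (tenH c p x) = - x + formu c p x *\<^sub>R vecU c p + formv c p x *\<^sub>R vecV c p \<and>
             tenG c p (J x) = - J (tenG c p x)) \<and>
        (\<forall>x y. metric M p (tenG c p x) y = - metric M p x (tenG c p y))"
  using patch unfolding contact_patch_def by (elim conjE)

lemma patch_du_dv:
  "\<forall>W X Y. open W \<and> W \<subseteq> pdom c \<and> smooth_vf (atlas M) W X \<and> smooth_vf (atlas M) W Y \<longrightarrow>
        (\<forall>p\<in>W.
           ext_d (atlas M) (formu c) X Y p
             = metric M p (X p) (tenG c p (Y p)) + wedge1 (sigma M c p) (formv c p) (X p) (Y p) \<and>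
           ext_d (atlas M) (formv c) X Y p
             = metric M p (X p) (tenH c p (Y p)) - wedge1 (sigma M c p) (formu c p) (X p) (Y p))"
  using patch unfolding contact_patch_def by (elim conjE)

context
  fixes y assumes y: "y \<in> pdom c"
begin

lemma u_U: "formu c y (vecU c y) = 1"
  and U_V: "metric M y (vecU c y) (vecV c y) = 0"
  and G_U: "tenG c y (vecU c y) = 0"
  and metric_U: "metric M y (vecU c y) x = formu c y x"
  and G_G: "tenG c y (tenG c y x) = - x + formu c y x *\<^sub>R vecU c y + formv c y x *\<^sub>R vecV c y"
  and G_J: "tenG c y (J x) = - J (tenG c y x)"
  and G_skew: "metric M y (tenG c y x) z = - metric M y x (tenG c y z)"
  using patch_algebra y by blast+

lemma linear_u: "linear (formu c y)" and linear_G: "linear (tenG c y)"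
  using smooth_u[unfolded smooth_form_def, THEN conjunct1] smooth_G[unfolded smooth_endo_def, THEN conjunct1] y
  by blast+

lemma linear_v: "linear (formv c y)"
  using linear_compose[OF linear_J linear_u] by (simp add: formv_def[abs_def] o_def)

lemma metric_V: "metric M y (vecV c y) x = formv c y x"
  using hermitian[of y "vecU c y" "J x"] metric_U
  by (simp add: formv_def vecV_def J_J metric_simps)

lemma v_U: "formv c y (vecU c y) = 0"
  using U_V metric_V by (simp add: metric_sym)

lemma H_U: "tenH c y (vecU c y) = 0"
  unfolding tenH_def using G_J G_U linear_0[OF linear_J] by simp

lemma horizontal_iff: "x \<in> horizontal M c y \<longleftrightarrow> formu c y x = 0 \<and> formv c y x = 0"
proof
  assume "x \<in> horizontal M c y"
  then have "metric M y x (vecU c y) = 0" "metric M y x (vecV c y) = 0"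
    unfolding horizontal_def vertical_def by (auto intro: span_base)
  then show "formu c y x = 0 \<and> formv c y x = 0" by (simp add: metric_U metric_V metric_sym[of y x])
next
  assume x: "formu c y x = 0 \<and> formv c y x = 0"
  have "metric M y x z = 0" if "z \<in> span {vecU c y, vecV c y}" for z
    using that
  proof (induction rule: span_induct)
    case base
    show ?case by (rule subspaceI) (simp_all add: metric_simps)
  next
    case step
    then show ?case using x by (auto simp: metric_U metric_V metric_sym[of y x])
  qed
  then show "x \<in> horizontal M c y" unfolding horizontal_def vertical_def by blast
qed

text \<open>The function \<open>u \<circ> G\<close> vanishes since \<open>G\<close> is skew with \<open>GU = 0\<close>, and \<open>v \<circ> G = u \<circ> J \<circ> G = - u \<circ> G \<circ> J\<close>.\<close>

lemma G_horizontal: "tenG c y x \<in> horizontal M c y"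
proof -
  have "formu c y (tenG c y z) = 0" for z
    using G_skew[of "vecU c y" z] metric_U G_U by (simp add: metric_simps)
  moreover from this[of "J x"] have "formu c y (J (tenG c y x)) = 0"
    by (simp add: G_J linear_neg[OF linear_u])
  ultimately show ?thesis by (simp add: horizontal_iff formv_def)
qed

lemma metric_G_G:
  assumes "z \<in> horizontal M c y"
  shows "metric M y (tenG c y x) (tenG c y z) = metric M y x z"
  using assms G_skew[of x "tenG c y z"] G_G[of z] by (simp add: horizontal_iff metric_simps)

end

abbreviation chart where "chart \<equiv> chart_at (atlas M) p"
abbreviation cf where "cf \<equiv> cfield (atlas M) chart"
abbreviation W where "W \<equiv> fst chart \<inter> pdom c"
abbreviation partial where "partial h a \<equiv> dfun (atlas M) h p a"
abbreviation vpartial where "vpartial Y a \<equiv> field_deriv (atlas M) p Y a"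

lemma chart: "chart \<in> atlas M" "p \<in> fst chart"
  using chart_at[OF atlas] by auto

lemma open_W: "open W" and p_W: "p \<in> W"
  using open_chart[OF open_pdom] chart p by auto

lemma cf_p: "cf w p = w"
  by (rule cfield_chart_at[OF atlas])

lemma smooth_cf: "smooth_vf (atlas M) W (cf w)"
  by (rule smooth_cfield)

lemma smooth_vecU: "smooth_vf (atlas M) W (vecU c)"
  using smooth_U by (rule smooth_vf_subset) auto

lemma smooth_vecV: "smooth_vf (atlas M) W (vecV c)"
  unfolding smooth_vf_def
proof
  fix e assume e: "e \<in> atlas M"
  let ?S = "snd e ` (fst e \<inter> W)"
  have op: "open ?S" using chart_image_open[OF atlas e open_W] .
  have bl: "bounded_linear (\<lambda>x :: complex ^ 'k. - J x)"
    by (rule linear_conv_bounded_linear[THEN iffD1]) (rule linear_compose_neg[OF linear_J])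
  have "smooth_on (\<lambda>x. - J (tcomp (atlas M) e (param e x) (vecU c (param e x)))) ?S"
    by (rule smooth_on_linear[OF op bl]) (use smooth_vecU e in \<open>simp add: smooth_vf_def\<close>)
  then show "smooth_on (\<lambda>x. tcomp (atlas M) e (param e x) (vecV c (param e x))) ?S"
    by (rule smooth_on_cong[OF op])
      (auto simp: vecV_def param_chart[OF atlas e] holomorphic_tcomp_J[OF holomorphic e]
        linear_neg[OF linear_tcomp[OF atlas e]])
qed

lemma smooth_G_cf: "smooth_vf (atlas M) W (\<lambda>x. tenG c x (cf w x))"
  using smooth_G[unfolded smooth_endo_def, THEN conjunct2, rule_format, of W "cf w"] open_W smooth_cf by blast

lemma smooth_u_cf: "smooth_fun (atlas M) W (\<lambda>x. formu c x (cf w x))"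
  using smooth_u[unfolded smooth_form_def, THEN conjunct2, rule_format, of W "cf w"] open_W smooth_cf by blast

lemma v_cf: "x \<in> W \<Longrightarrow> formv c x (cf w x) = formu c x (cf (J w) x)"
  by (simp add: formv_def holomorphic_cfield_J[OF holomorphic chart(1)])

lemma smooth_fun_cong:
  assumes "smooth_fun (atlas M) W h" "\<And>x. x \<in> W \<Longrightarrow> h x = h' x"
  shows "smooth_fun (atlas M) W h'"
  unfolding smooth_fun_def
proof
  fix e assume e: "e \<in> atlas M"
  show "smooth_on (h' \<circ> param e) (snd e ` (fst e \<inter> W))"
    by (rule smooth_on_cong[OF chart_image_open[OF atlas e open_W], of "h \<circ> param e"])
      (use assms e in \<open>auto simp: smooth_fun_def param_chart[OF atlas e]\<close>)
qed

lemma smooth_v_cf: "smooth_fun (atlas M) W (\<lambda>x. formv c x (cf w x))"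
  by (rule smooth_fun_cong[OF smooth_u_cf[of "J w"]]) (simp add: v_cf)

lemma smooth_sigma_cf: "smooth_fun (atlas M) W (\<lambda>x. sigma M c x (cf w x))"
  unfolding sigma_def
  by (intro smooth_metric open_W conn_smooth smooth_cf smooth_vecU smooth_vecV)

lemma linear_sigma: "x \<in> W \<Longrightarrow> linear (sigma M c x)"
  unfolding sigma_def
  by (rule linear_compose[OF conn_linear[OF open_W _ smooth_vecU], of x
        "\<lambda>z. metric M x z (vecV c x)", unfolded o_def])
    (use metric_bilinear in \<open>auto simp: bilinear_def\<close>)

lemma exterior_derivative_in_chart:
  fixes \<omega> :: "'a \<Rightarrow> complex ^ 'k \<Rightarrow> real"
  assumes x: "x \<in> W"
    and sm: "\<And>w. smooth_fun (atlas M) W (\<lambda>z. \<omega> z (cf w z))" and lin: "linear (\<omega> x)"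
  shows "2 * ext_d (atlas M) \<omega> (cf a) (cf b) x
      = frechet_derivative ((\<lambda>z. \<omega> z (cf b z)) \<circ> param chart) (at (snd chart x)) a
        - frechet_derivative ((\<lambda>z. \<omega> z (cf a z)) \<circ> param chart) (at (snd chart x)) b"
  using x
  by (simp add: ext_d_def lie_bracket_cfield[OF atlas chart(1)] linear_0[OF lin]
      dfun_in_chart[OF atlas chart(1) sm] tcomp_cfield_self[OF atlas chart(1)])

lemma du_in_chart:
  assumes x: "x \<in> W"
  shows "frechet_derivative ((\<lambda>z. formu c z (cf b z)) \<circ> param chart) (at (snd chart x)) a
        - frechet_derivative ((\<lambda>z. formu c z (cf a z)) \<circ> param chart) (at (snd chart x)) b
      = 2 * metric M x (cf a x) (tenG c x (cf b x))
        + sigma M c x (cf a x) * formv c x (cf b x) - sigma M c x (cf b x) * formv c x (cf a x)"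
proof -
  have "ext_d (atlas M) (formu c) (cf a) (cf b) x
      = metric M x (cf a x) (tenG c x (cf b x)) + wedge1 (sigma M c x) (formv c x) (cf a x) (cf b x)"
    using patch_du_dv x open_W smooth_cf by blast
  then show ?thesis
    using exterior_derivative_in_chart[OF x smooth_u_cf linear_u, of a b] x
    by (simp add: wedge1_def) argo
qed

lemma dv_in_chart:
  assumes x: "x \<in> W"
  shows "frechet_derivative ((\<lambda>z. formv c z (cf b z)) \<circ> param chart) (at (snd chart x)) a
        - frechet_derivative ((\<lambda>z. formv c z (cf a z)) \<circ> param chart) (at (snd chart x)) b
      = 2 * metric M x (cf a x) (tenH c x (cf b x))
        - sigma M c x (cf a x) * formu c x (cf b x) + sigma M c x (cf b x) * formu c x (cf a x)"
proof -
  have "ext_d (atlas M) (formv c) (cf a) (cf b) x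
      = metric M x (cf a x) (tenH c x (cf b x)) - wedge1 (sigma M c x) (formu c x) (cf a x) (cf b x)"
    using patch_du_dv x open_W smooth_cf by blast
  then show ?thesis
    using exterior_derivative_in_chart[OF x smooth_v_cf linear_v, of a b] x
    by (simp add: wedge1_def) argo
qed

lemma du_at: "partial (\<lambda>z. formu c z (cf b z)) a - partial (\<lambda>z. formu c z (cf a z)) b
    = 2 * metric M p a (tenG c p b) + sigma M c p a * formv c p b - sigma M c p b * formv c p a"
  using du_in_chart[OF p_W, of b a] by (simp add: dfun_def cf_p)

lemma dv_at: "partial (\<lambda>z. formv c z (cf b z)) a - partial (\<lambda>z. formv c z (cf a z)) b
    = 2 * metric M p a (tenH c p b) - sigma M c p a * formu c p b + sigma M c p b * formu c p a"
  using dv_in_chart[OF p_W, of b a] by (simp add: dfun_def cf_p)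

abbreviation Omega where "Omega a b x \<equiv> metric M x (cf a x) (tenG c x (cf b x))"

lemma smooth_Omega: "smooth_fun (atlas M) W (Omega a b)"
  by (intro smooth_metric open_W smooth_cf smooth_G_cf)

text \<open>This is \<open>d(du) = 0\<close> on \<open>U, X, Y\<close>, with \<open>du\<close> replaced by \<open>\<Omega> + \<sigma> \<and> v\<close>. Since \<open>v\<close> vanishes on all three
  vectors, the derivatives of \<open>\<sigma>\<close> drop out, and the derivatives of \<open>v\<close> combine to values of \<open>dv\<close>, which are prescribed by the
  contact structure. Of these, \<open>dv(U, Y)\<close> and \<open>dv(X, U)\<close> contribute multiples of \<open>\<sigma>(X) \<sigma>(Y)\<close> that cancel.\<close>

lemma d_du_at:
  assumes X: "x \<in> horizontal M c p" and Y: "y \<in> horizontal M c p"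
  shows "partial (Omega x y) (vecU c p) + partial (Omega y (vecU c p)) x + partial (Omega (vecU c p) x) y
    + sigma M c p (vecU c p) * metric M p y (tenH c p x) = 0"
proof -
  let ?u = "vecU c p" let ?o = "snd chart p" let ?S = "snd chart ` W"
  define \<alpha> where "\<alpha> w = (\<lambda>z. formu c z (cf w z)) \<circ> param chart" for w
  \<comment> \<open>The components of \<open>2 du\<close> in the chart.\<close>
  define \<beta> where "\<beta> z a b = frechet_derivative (\<lambda>z. \<alpha> b z) (at z) a - frechet_derivative (\<lambda>z. \<alpha> a z) (at z) b" for z a b
  have S: "open ?S" "?o \<in> ?S"
    using chart_nbhd[OF atlas chart(1) open_pdom chart(2) p] by (simp_all add: inf_commute)
  have der: "((\<lambda>x. h (param chart x)) has_derivative partial h) (at ?o)" if "smooth_fun (atlas M) W h" for h :: "'a \<Rightarrow> real"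
    using smooth_fun_chart_derivative[OF chart(1) that chart(2) p_W]
    unfolding dfun_def[abs_def] by (simp add: o_def)
  have d\<beta>: "frechet_derivative (\<lambda>z. \<beta> z b e) (at ?o) a
      = 2 * partial (Omega b e) a + sigma M c p b * partial (\<lambda>z. formv c z (cf e z)) a
        - sigma M c p e * partial (\<lambda>z. formv c z (cf b z)) a"
    if "formv c p b = 0" "formv c p e = 0" for a b e
  proof -
    have par: "param chart ?o = p" using param_chart[OF atlas chart] .
    let ?f = "\<lambda>z. 2 * Omega b e z + sigma M c z (cf b z) * formv c z (cf e z)
       - sigma M c z (cf e z) * formv c z (cf b z)"
    have "((\<lambda>x. ?f (param chart x)) has_derivative
       (\<lambda>a. 2 * partial (Omega b e) a + sigma M c p b * partial (\<lambda>z. formv c z (cf e z)) a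
        - sigma M c p e * partial (\<lambda>z. formv c z (cf b z)) a)) (at ?o)"
      by (rule has_derivative_eq_rhs, (rule derivative_intros der smooth_Omega smooth_sigma_cf smooth_v_cf)+)
        (auto simp: par cf_p that)
    then have "((\<lambda>z. \<beta> z b e) has_derivative
       (\<lambda>a. 2 * partial (Omega b e) a + sigma M c p b * partial (\<lambda>z. formv c z (cf e z)) a
        - sigma M c p e * partial (\<lambda>z. formv c z (cf b z)) a)) (at ?o)"
    proof (rule has_derivative_transform_within_open[OF _ S])
      fix z assume "z \<in> ?S"
      then obtain x where x: "x \<in> W" "z = snd chart x" by auto
      then have "param chart z = x" using param_chart[OF atlas chart(1)] by auto
      then show "?f (param chart z) = \<beta> z b e"
        unfolding \<beta>_def \<alpha>_def using du_in_chart[OF x(1), of e b] x(2) by simp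
    qed
      then show ?thesis by (rule frechet_derivative_apply)
  qed
  have "smooth_on (\<alpha> w) ?S" for w
    using smooth_u_cf[of w] chart(1) unfolding smooth_fun_def \<alpha>_def
    by (auto dest!: bspec[where x = chart] simp: Int_absorb1)
  then have "frechet_derivative (\<lambda>z. \<beta> z x y) (at ?o) ?u + frechet_derivative (\<lambda>z. \<beta> z y ?u) (at ?o) x
     + frechet_derivative (\<lambda>z. \<beta> z ?u x) (at ?o) y = 0"
    unfolding \<beta>_def by (rule exterior_derivative_closed[OF S, of "\<lambda>z w. \<alpha> w z"])
  moreover have "formv c p x = 0" "formv c p y = 0" "formv c p ?u = 0"
    "formu c p x = 0" "formu c p y = 0" "formu c p ?u = 1"
    using X Y p horizontal_iff v_U u_U by auto
  moreover have "metric M p ?u (tenH c p x) = 0" "metric M p ?u (tenH c p y) = 0"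
    using G_horizontal[OF p] p by (auto simp: metric_U tenH_def horizontal_iff)
  moreover have "metric M p x (tenH c p ?u) = 0" by (simp add: H_U[OF p] metric_simps)
  ultimately show ?thesis
    using dv_at[of y ?u] dv_at[of ?u x] dv_at[of x y] by (simp add: d\<beta>) algebra
qed

text \<open>The equation \<open>S(U, X) = 0\<close>, where \<open>X\<close> is extended by a coordinate field. Everything in \<open>S\<close> that contains \<open>GU\<close>, \<open>HU\<close> or
  \<open>v(U)\<close> vanishes.\<close>

lemma normality_at:
  "- tenG c p (tenG c p (vpartial (vecU c) x))
     - tenG c p (vpartial (\<lambda>z. tenG c z (cf x z)) (vecU c p) - vpartial (vecU c) (tenG c p x))
     + sigma M c p (vecU c p) *\<^sub>R tenG c p (tenH c p x) = 0"
proof -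
  have G0: "field_deriv (atlas M) p (\<lambda>z. tenG c z (vecU c z)) a = 0" for a
  proof -
    have "((\<lambda>x. tcomp (atlas M) chart (param chart x) (tenG c (param chart x) (vecU c (param chart x))))
        has_derivative (\<lambda>_. 0)) (at (snd chart p))"
      by (rule has_derivative_transform_within_open[OF has_derivative_const[of 0]
            chart_nbhd[OF atlas chart(1) open_pdom chart(2) p]])
        (auto simp: param_chart[OF atlas chart(1)] G_U linear_0[OF linear_tcomp[OF atlas chart(1)]])
    then show ?thesis unfolding field_deriv_def by (rule frechet_derivative_apply)
  qed
  have lin0: "field_deriv (atlas M) p Y 0 = 0" if "smooth_vf (atlas M) W Y" for Y
    unfolding field_deriv_def
    by (rule linear_0[OF has_derivative_linear[OF smooth_vf_chart_derivative[OF atlas chart(1) that chart(2) p_W]]])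
  have u_G: "formu c p (tenG c p z) = 0" for z
    using G_horizontal[OF p] horizontal_iff[OF p] by blast
  then have u_H: "formu c p (tenH c p z) = 0" for z by (simp add: tenH_def)
  have "tensor_S M c (vecU c) (cf x) p = 0"
    using normal c open_W p_W smooth_vecU smooth_cf unfolding normal_contact_def by blast
  then show ?thesis
    by (simp add: tensor_S_def Let_def nijenhuis_def lie_bracket_field_deriv cf_p
        field_deriv_cfield[OF atlas] G0 G_U[OF p] H_U[OF p] v_U[OF p] linear_0[OF linear_sigma[OF p_W]]
        lin0 smooth_G_cf smooth_cf linear_0[OF linear_G[OF p]] metric_simps metric_U[OF p] u_G u_H linear_neg[OF linear_G[OF p]])
qed

text \<open>With \<open>D\<close> for coordinate derivatives at the point, pairing \<open>normality_at\<close> with \<open>GY\<close> gives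
  \<open>- g(G D\<^sub>X U, Y) - g((D\<^sub>U G)X, Y) + g(D\<^sub>G\<^sub>X U, Y) + \<sigma>(U) g(HX, Y) = 0\<close>. Expanding \<open>d_du_at\<close> gives
  \<open>- (D\<^sub>U g)(GX, Y) - g((D\<^sub>U G)X, Y) - g(Y, G D\<^sub>X U) - g(D\<^sub>Y U, GX) + \<sigma>(U) g(Y, HX) = 0\<close>. Their difference is
  \<open>(D\<^sub>U g)(GX, Y) + g(D\<^sub>G\<^sub>X U, Y) + g(GX, D\<^sub>Y U) = 0\<close>, the vanishing of the Lie derivative of \<open>g\<close>
  along \<open>U\<close> on \<open>GX, Y\<close>. As the connection is torsion-free and metric, this is the claim.\<close>

lemma Killing_at:
  assumes X: "x \<in> horizontal M c p" and Y: "y \<in> horizontal M c p"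
  shows "metric M p (conn M p (tenG c p x) (vecU c)) y + metric M p (conn M p y (vecU c)) (tenG c p x) = 0"
proof -
  let ?u = "vecU c p" and ?G = "tenG c p" and ?g = "metric M p" and ?D = "vpartial (vecU c)"
  let ?DG = "vpartial (\<lambda>z. tenG c z (cf x z)) (vecU c p)"
  let ?s = "sigma M c p ?u"
  have skew: "Omega a b z = - metric M z (tenG c z (cf a z)) (cf b z)" if "z \<in> W" for a b z
    using that G_skew by simp
  \<comment> \<open>The functions \<open>g(U, G W)\<close> vanish identically, so differentiating them shifts the derivative to \<open>U\<close>.\<close>
  have U0: "partial (\<lambda>z. metric M z (vecU c z) (tenG c z (cf w z))) a = 0" for w a
  proof -
    have "partial (\<lambda>z. metric M z (vecU c z) (tenG c z (cf w z))) a = partial (\<lambda>z. 0) a"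
      by (rule dfun_cong[OF atlas open_W p_W])
        (use metric_U G_horizontal horizontal_iff in \<open>auto simp: smooth_fun_def intro!: smooth_on_const chart_image_open[OF atlas _ open_W]\<close>)
    then show ?thesis by (simp add: dfun_def o_def)
  qed
  have OU: "partial (Omega ?u w) a = - ?g (?D a) (?G w)" for w a
    using dfun_metric_chart[OF open_W p_W smooth_vecU smooth_G_cf[of w], of a] U0[of w a]
    by (simp add: cf_p)
  have O_skew: "partial (Omega a b) w = - partial (Omega b a) w" for a b w
  proof -
    have "Omega b a z = - Omega a b z" if "z \<in> W" for z
      using skew[OF that, of a b] metric_sym[of z "cf b z" "tenG c z (cf a z)"] by simp
    then have "partial (\<lambda>z. - Omega a b z) w = partial (Omega b a) w"
      by (intro dfun_cong[OF atlas open_W p_W smooth_Omega[of b a]])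
    then show ?thesis
      using dfun_minus[OF atlas p_W smooth_Omega[of a b], of w] by simp
  qed
  have OXY: "partial (Omega x y) ?u = - partial (\<lambda>z. metric M z (cf (?G x) z) (cf y z)) ?u - ?g ?DG y"
  proof -
    have sm: "smooth_fun (atlas M) W (\<lambda>z. metric M z (tenG c z (cf x z)) (cf y z))"
      by (intro smooth_metric open_W smooth_G_cf smooth_cf)
    have "partial (\<lambda>z. - Omega x y z) ?u = partial (\<lambda>z. metric M z (tenG c z (cf x z)) (cf y z)) ?u"
      by (rule dfun_cong[OF atlas open_W p_W sm]) (simp add: skew)
    then have "partial (Omega x y) ?u = - partial (\<lambda>z. metric M z (tenG c z (cf x z)) (cf y z)) ?u"
      using dfun_minus[OF atlas p_W smooth_Omega[of x y], of ?u] by simp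
    then show ?thesis
      using dfun_metric_chart[OF open_W p_W smooth_G_cf[of x] smooth_cf[of y], of ?u] by (simp add: cf_p)
  qed
  have lie: "conn M p ?u (cf w) = conn M p w (vecU c) - ?D w" for w
    using torsion_free[OF open_W p_W smooth_vecU smooth_cf[of w]]
    by (simp add: lie_bracket_field_deriv field_deriv_cfield[OF atlas] cf_p algebra_simps)
  have Lg: "partial (\<lambda>z. metric M z (cf (?G x) z) (cf y z)) ?u
      = ?g (conn M p (?G x) (vecU c)) y - ?g (?D (?G x)) y
        + ?g (conn M p y (vecU c)) (?G x) - ?g (?D y) (?G x)"
    using metric_compatible[OF open_W p_W smooth_cf[of "?G x"] smooth_cf[of y], of ?u]
    by (simp add: cf_p lie metric_simps metric_sym[of p "?G x"])
  have "?g (- ?G (?G (?D x)) - ?G (?DG - ?D (?G x)) + ?s *\<^sub>R ?G (tenH c p x)) (?G y) = 0"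
    unfolding normality_at by (simp add: metric_simps)
  then have "- ?g (?G (?D x)) y - ?g ?DG y + ?g (?D (?G x)) y + ?s * ?g (tenH c p x) y = 0"
    by (simp add: metric_simps metric_G_G[OF p Y] linear_diff[OF linear_G[OF p]])
  moreover have "partial (Omega x y) ?u + partial (Omega y ?u) x + partial (Omega ?u x) y
      + ?s * ?g (tenH c p x) y = 0"
    using d_du_at[OF X Y] by (simp only: metric_sym[of p y "tenH c p x"])
  ultimately show ?thesis
    using OXY Lg O_skew[of y ?u x] OU[of y x] OU[of x y] G_skew[OF p, of "?D x" y] by linarith
qed

text \<open>Half the sum of \<open>Killing_at\<close> and of the formula for \<open>2 du(GX, Y)\<close>, in which \<open>g(GX, GY) = g(X, Y)\<close>.\<close>

lemma metric_conn_U: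
  assumes X: "x \<in> horizontal M c p" and Y: "y \<in> horizontal M c p"
  shows "metric M p (conn M p (tenG c p x) (vecU c)) y = metric M p x y"
proof -
  let ?z = "tenG c p x"
  have u: "partial (\<lambda>z. formu c z (cf b z)) a
      = metric M p (conn M p a (vecU c)) b + metric M p (vecU c p) (conn M p a (cf b))" for a b
  proof -
    have "partial (\<lambda>z. formu c z (cf b z)) a = partial (\<lambda>z. metric M z (vecU c z) (cf b z)) a"
      by (rule dfun_cong[OF atlas open_W p_W])
        (auto intro!: smooth_metric open_W smooth_vecU smooth_cf simp: metric_U)
    then show ?thesis
      using metric_compatible[OF open_W p_W smooth_vecU smooth_cf[of b], of a] by (simp add: cf_p)
  qed
  have "conn M p ?z (cf y) = conn M p y (cf ?z)"
    using torsion_free[OF open_W p_W smooth_cf[of ?z] smooth_cf[of y]]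
      lie_bracket_cfield[OF atlas chart, of ?z y] by (simp add: cf_p)
  moreover have "formv c p ?z = 0" "formv c p y = 0"
    using G_horizontal[OF p] Y horizontal_iff[OF p] by auto
  ultimately show ?thesis
    using u[of y ?z] u[of ?z y] du_at[of y ?z] Killing_at[OF X Y] metric_G_G[OF p Y, of x] by simp
qed

end

section \<open>Null hypersurfaces with a screen distribution\<close>

lemma subbundleE:
  assumes "subbundle M N r E"
  obtains W e where "open W" "p \<in> W" "\<And>i. i < r \<Longrightarrow> smooth_along M N W (e i)"
    "\<And>q. q \<in> W \<Longrightarrow> E q = span ((\<lambda>i. e i q) ` {..<r})" "\<And>q. q \<in> W \<Longrightarrow> dim (E q) = r"
proof -
  from assms[unfolded subbundle_def, THEN spec, of p] that show ?thesis by (elim exE conjE) metis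
qed

locale null_hypersurface_with_screen = semi_riemannian_manifold M r
  for M :: "('a::topological_space, 'e::euclidean_space) ambient" and r +
  fixes N :: "('b::topological_space, 'f::euclidean_space, 'a, 'e) hypersurface"
  assumes null: "null_hypersurface M N" and screen: "screen_distribution M N"
begin

lemma immersed: "immersed_hypersurface M N"
  using null unfolding null_hypersurface_def by (elim conjE)

lemma hatlas: "smooth_atlas (hatlas N)"
  and continuous_emb: "continuous_on UNIV (emb N)"
  and dim_hypersurface: "DIM('f) + 1 = DIM('e)"
  and inj_tmap: "inj (tmap M N p)"
  and smooth_emb: "c \<in> hatlas N \<Longrightarrow> d \<in> atlas M \<Longrightarrow>
    smooth_on (snd d \<circ> emb N \<circ> param c) (snd c ` (fst c \<inter> emb N -` fst d))"
  using immersed unfolding immersed_hypersurface_def by auto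

lemma open_emb_vimage: "open V \<Longrightarrow> open (emb N -` V)"
  using continuous_emb continuous_on_open_vimage[of UNIV "emb N"] by simp

text \<open>The differential \<open>tmap\<close> is defined by the preferred charts; this is its expression in arbitrary charts.\<close>

lemma emb_has_derivative:
  assumes c: "c \<in> hatlas N" "p \<in> fst c" and d: "d \<in> atlas M" "emb N p \<in> fst d"
  shows "((snd d \<circ> emb N \<circ> param c) has_derivative
      (\<lambda>w. tcomp (atlas M) d (emb N p) (tmap M N p (cfield (hatlas N) c w p)))) (at (snd c p))"
proof -
  let ?c = "chart_at (hatlas N) p" and ?d = "chart_at (atlas M) (emb N p)"
  note c0 = chart_at[OF hatlas, of p] and d0 = chart_at[OF atlas, of "emb N p"]
  have tm: "((snd ?d \<circ> emb N \<circ> param ?c) has_derivative tmap M N p) (at (snd ?c p))"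
    unfolding tmap_def[abs_def]
    by (rule smooth_on_has_derivative[OF smooth_emb[OF c0(1) d0(1)]]) (use c0 d0 in auto)
  have par: "param ?c (snd ?c p) = p" "(snd ?c \<circ> param c) (snd c p) = snd ?c p"
    using param_chart[OF hatlas c0] param_chart[OF hatlas c] by auto
  have "((snd ?d \<circ> emb N \<circ> param ?c) \<circ> (snd ?c \<circ> param c) has_derivative
      tmap M N p \<circ> tchange c ?c p) (at (snd c p))"
    by (rule diff_chain_at[OF transition_has_derivative[OF hatlas c(1) c0(1) c(2) c0(2)]])
      (simp add: par tm del: o_apply)
  moreover have "((snd ?d \<circ> emb N \<circ> param ?c) \<circ> (snd ?c \<circ> param c)) (snd c p) = snd ?d (emb N p)"
    using par by simp
  ultimately have "((snd d \<circ> param ?d) \<circ> ((snd ?d \<circ> emb N \<circ> param ?c) \<circ> (snd ?c \<circ> param c)) has_derivative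
      tchange ?d d (emb N p) \<circ> (tmap M N p \<circ> tchange c ?c p)) (at (snd c p))"
    using transition_has_derivative[OF atlas d0(1) d(1) d0(2) d(2)] by (metis diff_chain_at)
  then have "((snd d \<circ> emb N \<circ> param c) has_derivative
      tchange ?d d (emb N p) \<circ> (tmap M N p \<circ> tchange c ?c p)) (at (snd c p))"
  proof (rule has_derivative_transform_within_open)
    let ?V = "fst ?c \<inter> emb N -` (fst d \<inter> fst ?d)"
    have "open ?V"
      using smooth_atlas_open[OF hatlas c0(1)] smooth_atlas_open[OF atlas d(1)]
        smooth_atlas_open[OF atlas d0(1)] by (intro open_Int open_emb_vimage)
    then show "open (snd c ` (fst c \<inter> ?V))" "snd c p \<in> snd c ` (fst c \<inter> ?V)"
      using chart_nbhd[OF hatlas c(1), of ?V p] c c0 d d0 by auto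
    fix x assume "x \<in> snd c ` (fst c \<inter> ?V)"
    then obtain z where z: "z \<in> fst c" "z \<in> fst ?c" "emb N z \<in> fst ?d" "x = snd c z" by auto
    then show "((snd d \<circ> param ?d) \<circ> ((snd ?d \<circ> emb N \<circ> param ?c) \<circ> (snd ?c \<circ> param c))) x
        = (snd d \<circ> emb N \<circ> param c) x"
      by (simp add: param_chart[OF hatlas c(1)] param_chart[OF hatlas c0(1)] param_chart[OF atlas d0(1)])
  qed
  moreover have "tchange ?d d (emb N p) \<circ> (tmap M N p \<circ> tchange c ?c p)
      = (\<lambda>w. tcomp (atlas M) d (emb N p) (tmap M N p (cfield (hatlas N) c w p)))"
    by (simp add: fun_eq_iff tcomp_def cfield_def)
  ultimately show ?thesis by simp
qed

lemma tmap_has_derivative: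
  "((snd (chart_at (atlas M) (emb N p)) \<circ> emb N \<circ> param (chart_at (hatlas N) p)) has_derivative tmap M N p)
     (at (snd (chart_at (hatlas N) p) p))"
  using emb_has_derivative[OF chart_at[OF hatlas] chart_at[OF atlas], of p]
  by (simp add: tcomp_chart_at[OF atlas] cfield_chart_at[OF hatlas])

lemma linear_tmap: "linear (tmap M N p)"
  using tmap_has_derivative by (rule has_derivative_linear)

lemma subspace_tangent: "subspace (tangent M N p)"
  unfolding tangent_def by (intro linear_subspace_image linear_tmap subspace_UNIV)

lemma dim_tangent: "dim (tangent M N p) = DIM('f)"
  unfolding tangent_def using dim_image_eq[OF linear_tmap, of p UNIV] inj_tmap[of p] by simp

lemma smooth_along_tmap:
  assumes c: "c \<in> hatlas N" and W: "W \<subseteq> fst c" "open W"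
  shows "smooth_along M N W (\<lambda>q. tmap M N q (cfield (hatlas N) c w q))"
  unfolding smooth_along_def
proof (intro ballI)
  fix e d assume e: "e \<in> hatlas N" and d: "d \<in> atlas M"
  let ?S = "snd e ` (fst e \<inter> W \<inter> emb N -` fst d)" and ?T = "snd c ` (fst c \<inter> emb N -` fst d)"
  have S: "open ?S" "open ?T"
    using chart_image_open[OF hatlas e, of "W \<inter> emb N -` fst d"] chart_image_open[OF hatlas c]
      open_emb_vimage smooth_atlas_open[OF atlas d] W by (auto simp: Int_assoc)
  have "(snd c \<circ> param e) ` ?S \<subseteq> ?T" using W by (auto simp: param_chart[OF hatlas e])
  moreover have "smooth_on (snd c \<circ> param e) ?S"
    by (rule smooth_on_subset[OF smooth_atlas_transition[OF hatlas e c]]) (use W in auto)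
  ultimately have "smooth_on ((\<lambda>y. frechet_derivative (snd d \<circ> emb N \<circ> param c) (at y) w) \<circ> (snd c \<circ> param e)) ?S"
    by (rule smooth_on_compose[OF S _ smooth_on_frechet[OF smooth_emb[OF c d]]])
  then show "smooth_on (\<lambda>x. tcomp (atlas M) d (emb N (param e x))
      (tmap M N (param e x) (cfield (hatlas N) c w (param e x)))) ?S"
  proof (rule smooth_on_cong[OF S(1)])
    fix x assume "x \<in> ?S"
    then obtain z where z: "z \<in> fst e" "z \<in> fst c" "emb N z \<in> fst d" "x = snd e z" using W by auto
    then show "((\<lambda>y. frechet_derivative (snd d \<circ> emb N \<circ> param c) (at y) w) \<circ> (snd c \<circ> param e)) x
      = tcomp (atlas M) d (emb N (param e x)) (tmap M N (param e x) (cfield (hatlas N) c w (param e x)))"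
      using frechet_derivative_apply[OF emb_has_derivative[OF c z(2) d z(3)], of w]
      by (simp add: param_chart[OF hatlas e] o_def)
  qed
qed

text \<open>Umbilicity and conformality are conditions on vector fields; a single tangent vector has to be extended before
  they apply to it.\<close>

lemma tangent_extension:
  assumes W: "W \<subseteq> fst (chart_at (hatlas N) p)" "open W" and v: "v \<in> tangent M N p"
  obtains X where "tangent_field M N W X" "X p = v"
proof -
  let ?c = "chart_at (hatlas N) p"
  obtain w where w: "v = tmap M N p w" using v unfolding tangent_def by auto
  let ?X = "\<lambda>q. tmap M N q (cfield (hatlas N) ?c w q)"
  have "tangent_field M N W ?X"
    unfolding tangent_field_def tangent_def
    using smooth_along_tmap[OF chart_at(1)[OF hatlas] W] by auto
  moreover have "?X p = v" by (simp add: w cfield_chart_at[OF hatlas])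
  ultimately show ?thesis by (rule that)
qed

lemma smooth_along_emb:
  assumes Y: "smooth_vf (atlas M) V Y" and V: "open V" and W: "open W" "emb N ` W \<subseteq> V"
  shows "smooth_along M N W (\<lambda>q. Y (emb N q))"
  unfolding smooth_along_def
proof (intro ballI)
  fix e d assume e: "e \<in> hatlas N" and d: "d \<in> atlas M"
  let ?S = "snd e ` (fst e \<inter> W \<inter> emb N -` fst d)" and ?T = "snd d ` (fst d \<inter> V)"
  have S: "open ?S" "open ?T"
    using chart_image_open[OF hatlas e, of "W \<inter> emb N -` fst d"] chart_image_open[OF atlas d V]
      open_emb_vimage smooth_atlas_open[OF atlas d] W by (auto simp: Int_assoc)
  have im: "(snd d \<circ> emb N \<circ> param e) ` ?S \<subseteq> ?T"
    using W by (fastforce simp: param_chart[OF hatlas e])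
  have "smooth_on (snd d \<circ> emb N \<circ> param e) ?S"
    by (rule smooth_on_subset[OF smooth_emb[OF e d]]) auto
  then have "smooth_on ((\<lambda>y. tcomp (atlas M) d (param d y) (Y (param d y))) \<circ> (snd d \<circ> emb N \<circ> param e)) ?S"
    using Y d unfolding smooth_vf_def by (intro smooth_on_compose[OF S im]) auto
  then show "smooth_on (\<lambda>x. tcomp (atlas M) d (emb N (param e x)) (Y (emb N (param e x)))) ?S"
    by (rule smooth_on_cong[OF S(1)]) (auto simp: param_chart[OF hatlas e] param_chart[OF atlas d])
qed

lemma conn_along_emb:
  assumes Y: "smooth_vf (atlas M) V Y" and V: "open V" and W: "open W" "p \<in> W" "emb N ` W \<subseteq> V"
    and Z: "\<And>q. q \<in> W \<Longrightarrow> Z q = Y (emb N q)" and v: "v \<in> tangent M N p"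
  shows "conn_along M N p v Z = conn M (emb N p) v Y"
proof -
  let ?c = "chart_at (hatlas N) p" and ?d = "chart_at (atlas M) (emb N p)"
  note c = chart_at[OF hatlas, of p] and d = chart_at[OF atlas, of "emb N p"]
  have p: "emb N p \<in> V" using W by auto
  let ?Y = "\<lambda>y. tcomp (atlas M) ?d (param ?d y) (Y (param ?d y))"
  have Yd: "(?Y has_derivative field_deriv (atlas M) (emb N p) Y) (at (snd ?d (emb N p)))"
    using smooth_vf_chart_derivative[OF atlas d(1) Y d(2) p] unfolding field_deriv_def[abs_def] .
  have "(?Y \<circ> (snd ?d \<circ> emb N \<circ> param ?c) has_derivative
      field_deriv (atlas M) (emb N p) Y \<circ> tmap M N p) (at (snd ?c p))"
    by (rule diff_chain_at[OF tmap_has_derivative]) (simp add: Yd param_chart[OF hatlas c])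
  then have "((\<lambda>x. tcomp (atlas M) ?d (emb N (param ?c x)) (Z (param ?c x))) has_derivative
      field_deriv (atlas M) (emb N p) Y \<circ> tmap M N p) (at (snd ?c p))"
  proof (rule has_derivative_transform_within_open)
    let ?S = "snd ?c ` (fst ?c \<inter> (W \<inter> emb N -` fst ?d))"
    show "open ?S" "snd ?c p \<in> ?S"
      using chart_nbhd[OF hatlas c(1), of "W \<inter> emb N -` fst ?d" p] c d W
        open_emb_vimage[OF smooth_atlas_open[OF atlas d(1)]] by auto
    fix x assume "x \<in> ?S"
    then show "(?Y \<circ> (snd ?d \<circ> emb N \<circ> param ?c)) x = tcomp (atlas M) ?d (emb N (param ?c x)) (Z (param ?c x))"
      using Z by (auto simp: param_chart[OF hatlas c(1)] param_chart[OF atlas d(1)])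
  qed
  then have "conn_along M N p v Z = field_deriv (atlas M) (emb N p) Y (tmap M N p (inv (tmap M N p) v))
      + conn M (emb N p) v (cfield (atlas M) ?d (Y (emb N p)))"
    unfolding conn_along_def Let_def using Z[OF W(2)] by (simp add: frechet_derivative_apply)
  also have "tmap M N p (inv (tmap M N p) v) = v"
    using v unfolding tangent_def by (rule f_inv_into_f)
  finally show ?thesis using conn_in_chart[OF V p Y] by simp
qed

lemma normal_space_eq_span:
  assumes x: "x \<in> normal_space M N p" "x \<noteq> 0"
  shows "normal_space M N p = span {x}"
proof -
  have "subbundle M N 1 (normal_space M N)"
    using null unfolding null_hypersurface_def by (elim conjE)
  then obtain W and e :: "nat \<Rightarrow> 'b \<Rightarrow> 'e" where "p \<in> W"
    and "\<And>q. q \<in> W \<Longrightarrow> normal_space M N q = span ((\<lambda>i. e i q) ` {..<1})"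
    by (rule subbundleE[where p = p]) blast
  then have e: "normal_space M N p = span ((\<lambda>i. e i p) ` {..<1})" by blast
  have "normal_space M N p = span {e 0 p}" using e by (simp add: lessThan_Suc)
  then obtain k where "x = k *\<^sub>R e 0 p" "k \<noteq> 0" using x by (auto simp: span_singleton)
  then have "e 0 p = (1/k) *\<^sub>R x" by simp
  then have "e 0 p \<in> span {x}" by (simp add: span_base span_scale)
  then have "span {e 0 p} \<subseteq> span {x}" by (intro span_minimal) auto
  moreover have "span {x} \<subseteq> span {e 0 p}"
    using x \<open>normal_space M N p = span {e 0 p}\<close> by (intro span_minimal) auto
  ultimately show ?thesis using \<open>normal_space M N p = span {e 0 p}\<close> by simp
qed

lemma local_null_section:
  obtains W \<xi> where "open W" "p \<in> W" "null_section M N W \<xi>"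
proof -
  have "subbundle M N 1 (normal_space M N)"
    using null unfolding null_hypersurface_def by (elim conjE)
  then obtain W and e :: "nat \<Rightarrow> 'b \<Rightarrow> 'e" where W: "open W" "p \<in> W"
    and sm: "\<And>i. i < 1 \<Longrightarrow> smooth_along M N W (e i)"
    and e: "\<And>q. q \<in> W \<Longrightarrow> normal_space M N q = span ((\<lambda>i. e i q) ` {..<1})"
      "\<And>q. q \<in> W \<Longrightarrow> dim (normal_space M N q) = 1"
    by (rule subbundleE[where p = p]) blast
  have "e 0 q \<in> normal_space M N q \<and> e 0 q \<noteq> 0" if "q \<in> W" for q
    using e[OF that] by (auto simp: lessThan_Suc span_base)
  then show ?thesis using sm W that[of W "e 0"] unfolding null_section_def by auto
qed

lemma screen_facts:
  shows screen_Int_normal: "screen N p \<inter> normal_space M N p = {0}"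
    and screen_plus_normal: "{s + w | s w. s \<in> screen N p \<and> w \<in> normal_space M N p} = tangent M N p"
  using screen unfolding screen_distribution_def by blast+

lemma subspace_screen: "subspace (screen N p)"
proof -
  have "subbundle M N (DIM('f) - 1) (screen N)"
    using screen unfolding screen_distribution_def by (rule conjunct1)
  then obtain W and e :: "nat \<Rightarrow> 'b \<Rightarrow> 'e" where "p \<in> W"
    and "\<And>q. q \<in> W \<Longrightarrow> screen N q = span ((\<lambda>i. e i q) ` {..<DIM('f) - 1})"
    by (rule subbundleE[where p = p]) blast
  then show ?thesis by simp
qed

lemma subspace_normal: "subspace (normal_space M N p)"
  unfolding normal_space_def by (rule subspaceI) (simp_all add: metric_simps)

lemma screen_plus_normal_tangent: "s \<in> screen N p \<Longrightarrow> w \<in> normal_space M N p \<Longrightarrow> s + w \<in> tangent M N p"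
  using screen_plus_normal by blast

lemma screen_subset_tangent: "screen N p \<subseteq> tangent M N p"
  using screen_plus_normal_tangent[of _ p 0] subspace_0[OF subspace_normal] by auto

lemma normal_subset_tangent: "normal_space M N p \<subseteq> tangent M N p"
  using screen_plus_normal_tangent[of 0 p] subspace_0[OF subspace_screen] by auto

lemma metric_normal_tangent: "x \<in> normal_space M N p \<Longrightarrow> z \<in> tangent M N p \<Longrightarrow> metric M (emb N p) x z = 0"
  unfolding normal_space_def by blast

lemma screen_proj_screen:
  assumes "x \<in> screen N p"
  shows "screen_proj M N p x = x"
  unfolding screen_proj_def
proof (rule the_equality)
  show "x \<in> screen N p \<and> x - x \<in> normal_space M N p"
    using assms subspace_0[OF subspace_normal] by simp
  fix s assume s: "s \<in> screen N p \<and> x - s \<in> normal_space M N p"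
  then have "x - s \<in> screen N p \<inter> normal_space M N p"
    using assms subspace_diff[OF subspace_screen] by blast
  then show "s = x" using screen_Int_normal[of p] by auto
qed

lemma metric_representation:
  obtains A where "surj A" "\<And>x y. metric M q x y = A x \<bullet> y"
proof -
  define A where "A x = (\<Sum>b\<in>Basis. metric M q x b *\<^sub>R b)" for x :: 'e
  have rep: "metric M q x y = A x \<bullet> y" for x y
  proof -
    interpret linear "metric M q x" using metric_bilinear[of q] by (simp add: bilinear_def)
    have "metric M q x y = metric M q x (\<Sum>b\<in>Basis. (y \<bullet> b) *\<^sub>R b)" by (simp add: euclidean_representation)
    also have "\<dots> = A x \<bullet> y"
      by (simp add: A_def sum scale inner_sum_left inner_commute[of y] mult.commute)
    finally show ?thesis .
  qed
  have lin: "linear A"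
    by (rule linearI) (simp_all add: A_def metric_simps scaleR_left_distrib sum.distrib scaleR_sum_right)
  have "inj A"
    using metric_nondegenerate[of q] by (simp add: linear_injective_0[OF lin] rep)
  then have "surj A" using lin linear_injective_imp_surjective by blast
  then show ?thesis using that rep by blast
qed

text \<open>The tangent space is contained in the orthogonal complement of \<open>\<xi>\<close>, which is a hyperplane because the ambient metric is
  nondegenerate; so the two agree for dimensional reasons.\<close>

lemma tangent_eq:
  assumes x: "x \<in> normal_space M N p" "x \<noteq> 0"
  shows "tangent M N p = {y. metric M (emb N p) x y = 0}"
proof (rule subspace_dim_equal[OF subspace_tangent])
  obtain A where A: "surj A" "\<And>x y. metric M (emb N p) x y = A x \<bullet> y"
    by (rule metric_representation[where q = "emb N p"]) simp
  have "A x \<noteq> 0" using metric_nondegenerate[of "emb N p" x] x(2) A(2) by (metis inner_zero_left)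
  then have "dim {y. metric M (emb N p) x y = 0} = DIM('e) - 1"
    unfolding A(2) by (rule dim_hyperplane)
  then show "dim {y. metric M (emb N p) x y = 0} \<le> dim (tangent M N p)"
    using dim_tangent dim_hypersurface by simp
  show "subspace {y. metric M (emb N p) x y = 0}"
    by (rule subspaceI) (simp_all add: metric_simps)
  show "tangent M N p \<subseteq> {y. metric M (emb N p) x y = 0}"
    using metric_normal_tangent[OF x(1)] by blast
qed

text \<open>Existence: \<open>\<xi>\<close> is not in the screen, so some \<open>w\<close> is orthogonal to the screen with \<open>g(w, \<xi>) = 1\<close>, and a multiple of
  \<open>\<xi>\<close> can be subtracted to make it null. Uniqueness: the difference of two candidates is orthogonal to the
  tangent space, hence equal to \<open>k \<xi>\<close> for some \<open>k\<close>, and comparing the squares gives \<open>2k = 0\<close>.\<close>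

lemma null_transversal:
  assumes x: "x \<in> normal_space M N p" "x \<noteq> 0"
  defines "n \<equiv> null_transversal M N p x"
  shows "metric M (emb N p) x n = 1" "metric M (emb N p) n n = 0"
    and "z \<in> screen N p \<Longrightarrow> metric M (emb N p) n z = 0"
proof -
  let ?g = "metric M (emb N p)"
  let ?P = "\<lambda>n. ?g x n = 1 \<and> ?g n n = 0 \<and> (\<forall>z\<in>screen N p. ?g n z = 0)"
  have xx: "?g x x = 0"
    using metric_normal_tangent[OF x(1)] x(1) normal_subset_tangent by blast
  have xs: "?g x z = 0" if "z \<in> screen N p" for z
    using metric_normal_tangent[OF x(1)] screen_subset_tangent that by blast
  have "\<exists>n. ?P n"
  proof -
    obtain A where A: "surj A" "\<And>x y. ?g x y = A x \<bullet> y"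
      by (rule metric_representation[where q = "emb N p"]) simp
    have "x \<notin> screen N p" using x screen_Int_normal[of p] by auto
    \<comment> \<open>The Euclidean inner product serves as an auxiliary device: \<open>z\<close> is Euclidean-orthogonal to the screen, so
      its preimage under \<open>A\<close> is orthogonal to the screen with respect to the metric.\<close>
    obtain y z where yz: "y \<in> span (screen N p)" "\<And>w. w \<in> span (screen N p) \<Longrightarrow> orthogonal z w" "x = y + z"
      using orthogonal_subspace_decomp_exists[of "screen N p" x] by blast
    have span: "span (screen N p) = screen N p" using subspace_screen by (simp add: span_eq_iff)
    have "z \<noteq> 0" using yz \<open>x \<notin> screen N p\<close> span by auto
    have zy: "z \<bullet> y = 0" using yz(1,2) by (simp add: orthogonal_def)
    obtain w where w: "A w = (1 / (z \<bullet> z)) *\<^sub>R z" using A(1) by (metis surjD)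
    have w1: "?g w x = 1" using zy \<open>z \<noteq> 0\<close> by (simp add: A(2) w yz(3) inner_add_right)
    have w2: "?g w s = 0" if "s \<in> screen N p" for s
      using yz(2)[of s] that span by (simp add: A(2) w orthogonal_def)
    have "?P (w - (?g w w / 2) *\<^sub>R x)"
      using w1 w2 xx xs metric_sym[of "emb N p" x w] by (simp add: metric_simps)
    then show ?thesis by blast
  qed
  moreover have "m = m'" if m: "?P m" "?P m'" for m m'
  proof -
    have "m - m' \<in> normal_space M N p"
      unfolding normal_space_def
    proof (intro CollectI ballI)
      fix t assume "t \<in> tangent M N p"
      then obtain s w where t: "t = s + w" "s \<in> screen N p" "w \<in> normal_space M N p"
        using screen_plus_normal[of p] by blast
      then obtain k where "w = k *\<^sub>R x" using normal_space_eq_span[OF x] by (auto simp: span_singleton)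
      then show "?g (m - m') t = 0"
        using m t metric_sym[of "emb N p" m x] metric_sym[of "emb N p" m' x] by (simp add: metric_simps)
    qed
    then obtain k where "m - m' = k *\<^sub>R x" using normal_space_eq_span[OF x] by (auto simp: span_singleton)
    then have eq: "m = m' + k *\<^sub>R x" by (simp add: algebra_simps)
    have "?g m m = 2 * k"
      unfolding eq using m xx metric_sym[of "emb N p" m' x] by (simp add: metric_simps)
    then show "m = m'" using m eq by simp
  qed
  ultimately have "?P n" unfolding n_def null_transversal_def by (rule ex_ex1I[THEN theI'])
  then show "?g x n = 1" "?g n n = 0" "z \<in> screen N p \<Longrightarrow> ?g n z = 0" by auto
qed

context
  fixes \<xi> :: "'b \<Rightarrow> 'e" and p :: 'b
  assumes \<xi>: "\<xi> p \<in> normal_space M N p" "\<xi> p \<noteq> 0"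
begin

text \<open>The tangent space is the orthogonal complement of \<open>\<xi>\<close>, and \<open>g(\<xi>, N) = 1\<close>; so pairing with \<open>\<xi>\<close> reads off the coefficient of \<open>N\<close>.\<close>

lemma gauss_decomposition:
  fixes w
  defines "n \<equiv> null_transversal M N p (\<xi> p)"
  shows "t \<in> tangent M N p \<and> w = t + b *\<^sub>R n \<longleftrightarrow>
     b = metric M (emb N p) (\<xi> p) w \<and> t = w - b *\<^sub>R n"
  using null_transversal(1)[OF \<xi>] unfolding tangent_eq[OF \<xi>] n_def
  by (auto simp: metric_simps)

lemma second_form_eq: "second_form M N \<xi> X Y p = metric M (emb N p) (\<xi> p) (conn_along M N p (X p) Y)"
proof -
  have "(\<exists>t\<in>tangent M N p. conn_along M N p (X p) Y = t + b *\<^sub>R null_transversal M N p (\<xi> p))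
    \<longleftrightarrow> b = metric M (emb N p) (\<xi> p) (conn_along M N p (X p) Y)" for b
    using gauss_decomposition[of _ "conn_along M N p (X p) Y" b] by blast
  then show ?thesis unfolding second_form_def by simp
qed

lemma induced_conn_eq: "induced_conn M N \<xi> X Y p = conn_along M N p (X p) Y
    - metric M (emb N p) (\<xi> p) (conn_along M N p (X p) Y) *\<^sub>R null_transversal M N p (\<xi> p)"
proof -
  let ?w = "conn_along M N p (X p) Y" and ?n = "null_transversal M N p (\<xi> p)"
  have "(t \<in> tangent M N p \<and> (\<exists>b. ?w = t + b *\<^sub>R ?n))
    \<longleftrightarrow> t = ?w - metric M (emb N p) (\<xi> p) ?w *\<^sub>R ?n" for t
  proof -
    have "(t \<in> tangent M N p \<and> (\<exists>b. ?w = t + b *\<^sub>R ?n)) \<longleftrightarrow> (\<exists>b. t \<in> tangent M N p \<and> ?w = t + b *\<^sub>R ?n)"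
      by simp
    also have "\<dots> \<longleftrightarrow> t = ?w - metric M (emb N p) (\<xi> p) ?w *\<^sub>R ?n"
      unfolding gauss_decomposition by simp
    finally show ?thesis .
  qed
  then show ?thesis unfolding induced_conn_def by simp
qed

lemma screen_form_eq: "screen_form M N \<xi> X Z p
    = metric M (emb N p) (null_transversal M N p (\<xi> p)) (conn_along M N p (X p) Z)"
proof -
  let ?g = "metric M (emb N p)" and ?n = "null_transversal M N p (\<xi> p)"
  let ?t = "induced_conn M N \<xi> X Z p"
  note n = null_transversal[OF \<xi>]
  have t: "?g ?n ?t = ?g ?n (conn_along M N p (X p) Z)"
    by (simp add: induced_conn_eq metric_simps n)
  have "?t \<in> tangent M N p"
    using gauss_decomposition[of ?t "conn_along M N p (X p) Z"] induced_conn_eq by blast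
  then obtain s w where st: "?t = s + w" "s \<in> screen N p" "w \<in> normal_space M N p"
    using screen_plus_normal[of p] by blast
  then obtain k where k: "w = k *\<^sub>R \<xi> p" using normal_space_eq_span[OF \<xi>] by (auto simp: span_singleton)
  have coef: "b = ?g ?n ?t" if "s' \<in> screen N p" "?t = s' + b *\<^sub>R \<xi> p" for b s'
    unfolding that(2) using n that(1) metric_sym[of "emb N p" ?n "\<xi> p"] by (simp add: metric_simps)
  show ?thesis
    unfolding screen_form_def t[symmetric]
    by (rule the_equality) (use st k coef in blast)+
qed

end

end

section \<open>Nonexistence\<close>

theorem theorem3p10:
  fixes M :: "('a::{t2_space, second_countable_topology}, complex ^ 'k) ambient"
    and \<C> :: "('a, complex ^ 'k) patch set"
    and N :: "('b::{t2_space, second_countable_topology}, 'f::euclidean_space, 'a, complex ^ 'k) hypersurface"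
    and n q :: nat
  assumes "indefinite_complex_contact n q M \<C>" and "normal_contact M \<C>"
    and "null_hypersurface M N" and "tangent_to_vertical M \<C> N"
    and "screen_distribution M N" and "adapted_screen M \<C> N"
  shows "\<not> totally_umbilic M N \<and> \<not> screen_totally_umbilic M N \<and> \<not> screen_conformal M N"
proof -
  \<comment> \<open>A hypersurface is modelled on a type, hence nonempty; any of its points leads to a contradiction.\<close>
  obtain p :: 'b where True by simp
  have "(\<Union>c\<in>\<C>. pdom c) = UNIV"
    using assms(1) unfolding indefinite_complex_contact_def by (elim conjE)
  then obtain c where c: "c \<in> \<C>" "emb N p \<in> pdom c" by blast
  interpret C: normal_contact_point n q M \<C> c "emb N p"
    by unfold_locales (use assms c in auto)
  interpret H: null_hypersurface_with_screen M "4 * q" N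
    by unfold_locales (use assms in auto)
  let ?A = "hatlas N" and ?c = "chart_at (hatlas N) p"
  let ?g = "metric M (emb N p)" and ?G = "tenG c (emb N p)"
  let ?U = "\<lambda>q. vecU c (emb N q)"
  obtain W0 \<xi> where W0: "open W0" "p \<in> W0" "null_section M N W0 \<xi>"
    using H.local_null_section by blast
  \<comment> \<open>A coordinate neighbourhood of \<open>p\<close> that carries a null section and is mapped into a single contact patch.\<close>
  define W where "W = fst ?c \<inter> (W0 \<inter> emb N -` pdom c)"
  have op: "open (W0 \<inter> emb N -` pdom c)" using W0 H.open_emb_vimage[OF C.open_pdom] by auto
  have W: "open W" "p \<in> W" "W \<subseteq> fst ?c" "W \<subseteq> W0" "emb N ` W \<subseteq> pdom c"
    using op smooth_atlas_open[OF H.hatlas chart_at(1)[OF H.hatlas]] chart_at(2)[OF H.hatlas] W0 c(2)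
    unfolding W_def by auto
  have nbhd: "coord_nbhd ?A W"
    unfolding coord_nbhd_def W_def
    using smooth_atlas_restrict_chart[OF H.hatlas chart_at(1)[OF H.hatlas] op] by blast
  have "smooth_along M N W \<xi>"
    using W0(3) W(4) unfolding null_section_def smooth_along_def
    by (blast intro: smooth_on_subset)
  then have sec: "null_section M N W \<xi>" using W0(3) W(4) unfolding null_section_def by blast
  then have \<xi>: "\<xi> p \<in> normal_space M N p" "\<xi> p \<noteq> 0" using W(2) unfolding null_section_def by auto
  define \<nu> where "\<nu> = null_transversal M N p (\<xi> p)"
  note \<nu> = H.null_transversal[OF \<xi>, folded \<nu>_def]
  have vert: "vertical c (emb N q) \<subseteq> screen N q" if "q \<in> W" for q
    using assms(6) c W(5) that unfolding adapted_screen_def by blast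
  have screenU: "?U q \<in> screen N q" if "q \<in> W" for q
    using vert[OF that] unfolding vertical_def by (auto intro: span_base)
  have tU: "tangent_field M N W ?U"
    unfolding tangent_field_def
    using H.smooth_along_emb[OF C.smooth_U C.open_pdom W(1,5)] screenU H.screen_subset_tangent by blast
  have "\<nu> \<in> transversal_space M N p"
    unfolding transversal_space_def \<nu>_def using \<xi> by (auto intro: span_base)
  then have GS: "?G (\<xi> p) \<in> screen N p" "?G \<nu> \<in> screen N p"
    using assms(6) c \<xi> unfolding adapted_screen_def by blast+
  have hor: "\<xi> p \<in> horizontal M c (emb N p)" "\<nu> \<in> horizontal M c (emb N p)"
    unfolding horizontal_def
    using H.metric_normal_tangent[OF \<xi>(1)] \<nu>(3) vert[OF W(2)] H.screen_subset_tangent[of p] by blast+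
  have gU: "?g (?G x) (?U p) = 0" for x
    using C.G_horizontal[OF c(2)] C.horizontal_iff[OF c(2)] C.metric_U[OF c(2)] C.metric_sym by metis
  obtain X where X: "tangent_field M N W X" "X p = ?G (\<xi> p)"
    using H.tangent_extension[OF W(3,1)] GS(1) H.screen_subset_tangent by blast
  obtain X' where X': "tangent_field M N W X'" "X' p = ?G \<nu>"
    using H.tangent_extension[OF W(3,1)] GS(2) H.screen_subset_tangent by blast
  have ca: "conn_along M N p v Z = conn M (emb N p) v (vecU c)"
    if "\<And>q. q \<in> W \<Longrightarrow> Z q = ?U q" "v \<in> screen N p" for v Z
    using H.conn_along_emb[OF C.smooth_U C.open_pdom W(1,2,5)] that H.screen_subset_tangent by blast
  let ?PU = "\<lambda>q. screen_proj M N q (?U q)"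
  have PU: "?PU q = ?U q" if "q \<in> W" for q
    using H.screen_proj_screen[OF screenU[OF that]] .
  have B_eq: "second_form M N \<xi> Y Z p = ?g (conn M (emb N p) (Y p) (vecU c)) (\<xi> p)"
    and C_eq: "screen_form M N \<xi> Y Z p = ?g (conn M (emb N p) (Y p) (vecU c)) \<nu>"
    if "Y p \<in> screen N p" "\<And>q. q \<in> W \<Longrightarrow> Z q = ?U q" for Y Z
    using H.second_form_eq[where \<xi> = \<xi> and p = p, OF \<xi>, of Y Z]
      H.screen_form_eq[where \<xi> = \<xi> and p = p, OF \<xi>, of Y Z]
      ca[OF that(2,1)] C.metric_sym by (simp_all add: \<nu>_def)
  have "?g (\<xi> p) (\<xi> p) = 0"
    using H.metric_normal_tangent[OF \<xi>(1)] H.normal_subset_tangent \<xi>(1) by blast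
  then have B: "second_form M N \<xi> X' ?PU p = 1" "second_form M N \<xi> X ?U p = 0"
    and C: "screen_form M N \<xi> X ?PU p = 1"
    using B_eq[of X' ?PU] B_eq[of X ?U] C_eq[of X ?PU] PU GS \<nu>(1) C.metric_sym[of "emb N p" \<nu>]
    by (simp_all add: X(2) X'(2) C.metric_conn_U hor)
  show ?thesis
  proof (intro conjI notI)
    assume "totally_umbilic M N"
    then obtain \<rho> :: "'b \<Rightarrow> real" where "\<forall>X Y. tangent_field M N W X \<and> tangent_field M N W Y \<longrightarrow>
        (\<forall>p\<in>W. second_form M N \<xi> X (\<lambda>q. screen_proj M N q (Y q)) p = \<rho> p * metric M (emb N p) (X p) (Y p))"
      using nbhd sec unfolding totally_umbilic_def by blast
    then have "second_form M N \<xi> X' ?PU p = \<rho> p * ?g (X' p) (?U p)" using X'(1) tU W(2) by blast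
    then show False using B(1) gU X'(2) by simp
  next
    assume "screen_totally_umbilic M N"
    then obtain \<rho> :: "'b \<Rightarrow> real" where "\<forall>X Y. tangent_field M N W X \<and> tangent_field M N W Y \<longrightarrow>
        (\<forall>p\<in>W. screen_form M N \<xi> X (\<lambda>q. screen_proj M N q (Y q)) p = \<rho> p * metric M (emb N p) (X p) (Y p))"
      using nbhd sec unfolding screen_totally_umbilic_def by blast
    then have "screen_form M N \<xi> X ?PU p = \<rho> p * ?g (X p) (?U p)" using X(1) tU W(2) by blast
    then show False using C gU X(2) by simp
  next
    assume "screen_conformal M N"
    then obtain \<psi> :: "'b \<Rightarrow> real" where "\<forall>X Y. tangent_field M N W X \<and> tangent_field M N W Y \<longrightarrow>
        (\<forall>p\<in>W. screen_form M N \<xi> X (\<lambda>q. screen_proj M N q (Y q)) p = \<psi> p * second_form M N \<xi> X Y p)"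
      using nbhd sec unfolding screen_conformal_def by blast
    then have "screen_form M N \<xi> X ?PU p = \<psi> p * second_form M N \<xi> X ?U p" using X(1) tU W(2) by blast
    then show False using C B(2) by simp
  qed
qed

end
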